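(* Let $a,b,c,\mu\in\mathbb{C}$. In each identity below assume that the arguments of the three gamma functions in the numerator on the right-hand side have positive real parts, and that the lower (third) parameters of the hypergeometric functions in the two $w_j$'s occurring are not in $\mathbb{Z}_{\le0}$. (1) For $x\in(0,1)\cup(1,\infty)$: $$\int_{-\infty}^0w_2(y;a,b,c)(x-y)^{\mu-1}dy=\frac{\Gamma(a-\mu)\Gamma(b-\mu)\Gamma(2-c)}{\Gamma(a+b-c-\mu+1)\Gamma(1-\mu)}\,w_5(x;a-\mu,b-\mu,c-\mu).$$ (2) For $x\in(-\infty,0)\cup(0,1)$: $$\int_1^\infty w_6(y;a,b,c)(y-x)^{\mu-1}dy=\frac{\Gamma(a-\mu)\Gamma(b-\mu)\Gamma(c-a-b+1)}{\Gamma(c-\mu)\Gamma(1-\mu)}\,w_1(x;a-\mu,b-\mu,c-\mu).$$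
   Context: Write $F(a,b;c;z)={}_2F_1(a,b;c;z)$ for the Gauss hypergeometric function (power series for $|z|<1$, analytically continued to $\mathbb{C}\setminus[1,\infty)$, with $c\notin\mathbb{Z}_{\le0}$). Define $w_1(x;a,b,c)=F(a,b;c;x)$ for $x\in(-\infty,1)$; $w_2(x;a,b,c)=|x|^{1-c}F(a-c+1,b-c+1;2-c;x)$ for $x\in(-\infty,0)\cup(0,1)$; $w_5(x;a,b,c)=F(a,b;a+b-c+1;1-x)$ for $x\in(0,\infty)$; $w_6(x;a,b,c)=|1-x|^{c-a-b}F(c-a,c-b;c-a-b+1;1-x)$ for $x\in(0,1)\cup(1,\infty)$. Convention: $1/\Gamma$ is entire, with value $0$ at nonpositive integers. *)

theory Defs
  imports "HOL-Complex_Analysis.Complex_Analysis"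
begin

definition hyp2f1_domain :: "complex set" where
  "hyp2f1_domain = UNIV - complex_of_real ` {1..}"

text \<open>
  For \<open>c \<notin> \<int>\<^sub>\<le>\<^sub>0\<close> the power series converges on the unit disc, and its analytic continuation to
  the star-shaped domain above exists because the hypergeometric differential equation is regular
  away from \<open>0\<close>, \<open>1\<close>, \<open>\<infinity>\<close>. By the identity theorem any two functions satisfying the predicate
  agree on that domain, so the choice operator only affects values on the cut.
\<close>
definition hyp2f1 :: "complex \<Rightarrow> complex \<Rightarrow> complex \<Rightarrow> complex \<Rightarrow> complex" where
  "hyp2f1 a b c = (SOME f. f holomorphic_on hyp2f1_domain \<and>
     (\<forall>z. norm z < 1 \<longrightarrow>
        f z = (\<Sum>n. pochhammer a n * pochhammer b n / (pochhammer c n * fact n) * z ^ n)))"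

text \<open>
  The functions below are meaningful for \<open>x < 1\<close>; \<open>x < 1\<close>, \<open>x \<noteq> 0\<close>; \<open>x > 0\<close>; and \<open>x > 0\<close>, \<open>x \<noteq> 1\<close>,
  respectively.
\<close>
definition w1 :: "real \<Rightarrow> complex \<Rightarrow> complex \<Rightarrow> complex \<Rightarrow> complex" where
  "w1 x a b c = hyp2f1 a b c (complex_of_real x)"

definition w2 :: "real \<Rightarrow> complex \<Rightarrow> complex \<Rightarrow> complex \<Rightarrow> complex" where
  "w2 x a b c = complex_of_real \<bar>x\<bar> powr (1 - c) *
     hyp2f1 (a - c + 1) (b - c + 1) (2 - c) (complex_of_real x)"

definition w5 :: "real \<Rightarrow> complex \<Rightarrow> complex \<Rightarrow> complex \<Rightarrow> complex" where
  "w5 x a b c = hyp2f1 a b (a + b - c + 1) (complex_of_real (1 - x))"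

definition w6 :: "real \<Rightarrow> complex \<Rightarrow> complex \<Rightarrow> complex \<Rightarrow> complex" where
  "w6 x a b c = complex_of_real \<bar>1 - x\<bar> powr (c - a - b) *
     hyp2f1 (c - a) (c - b) (c - a - b + 1) (complex_of_real (1 - x))"

end

theory Submission
  imports Defs
begin

text \<open>
  After \<open>y = -t\<close> and \<open>y = 1 + t\<close>, respectively, both identities become instances of
  \[ \int_0^\infty t^{C-1} F(A,B;C;-t)\, (1-z+t)^{-s}\, dt =
     \frac{\Gamma(C)\Gamma(\alpha)\Gamma(\beta)}{\Gamma(\gamma)\Gamma(s)} F(\alpha,\beta;\gamma;z),
     \quad \alpha = A-C+s,\ \beta = B-C+s,\ \gamma = A+B-C+s. \]
  By Pfaff's transformation \<open>F(A,B;C;-t)\<close> is \<open>(1+t)\<^bsup>-A\<^esup>\<close> times a power series in \<open>t/(1+t)\<close>.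
  For \<open>z = 0\<close>, integrating that series termwise yields Beta integrals, and Gauss's summation theorem
  evaluates the resulting series at \<open>1\<close>. Expanding \<open>(1-z+t)\<^bsup>-s\<^esup>\<close> in powers of \<open>z\<close> reduces \<open>|z| < 1\<close>
  to the case \<open>z = 0\<close> with \<open>s + n\<close> in place of \<open>s\<close>, and the identity theorem does the rest.

  Read from right to left, with \<open>F(A,B;C;-t)\<close> replaced by its Pfaff form and \<open>Re s\<close> large, the same
  formula continues \<open>F(\<alpha>,\<beta>;\<gamma>;z)\<close> analytically to the slit plane when \<open>Re \<alpha>\<close> and \<open>Re \<beta>\<close> are positive;
  a contiguous relation removes the two positivity conditions.
\<close>

section \<open>Hypergeometric coefficients and Gauss's summation theorem\<close>

definition hyp_coeff :: "complex \<Rightarrow> complex \<Rightarrow> complex \<Rightarrow> nat \<Rightarrow> complex" where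
  "hyp_coeff a b c n = pochhammer a n * pochhammer b n / (pochhammer c n * fact n)"

lemma hyp_coeff_0 [simp]: "hyp_coeff a b c 0 = 1"
  by (simp add: hyp_coeff_def)

lemma hyp_coeff_commute: "hyp_coeff a b c n = hyp_coeff b a c n"
  by (simp add: hyp_coeff_def mult_ac)

text \<open>Valid for every \<open>c\<close>: if \<open>c + of_nat n\<close> is zero, both sides
  vanish by the convention for division by zero. This is why the convergence lemmas below carry no
  condition on \<open>c\<close>.\<close>

lemma hyp_coeff_Suc:
  "hyp_coeff a b c (Suc n) =
     hyp_coeff a b c n * ((a + of_nat n) * (b + of_nat n) / ((c + of_nat n) * of_nat (Suc n)))"
  by (simp add: hyp_coeff_def pochhammer_Suc mult_ac)

lemma pos_Re_not_nonpos_Int: "Re z > 0 \<Longrightarrow> z \<notin> \<int>\<^sub>\<le>\<^sub>0"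
  by (auto elim!: nonpos_Ints_cases)

lemma not_nonpos_Int_add_of_nat: "c \<notin> \<int>\<^sub>\<le>\<^sub>0 \<Longrightarrow> c + of_nat n \<noteq> (0 :: complex)"
  using plus_of_nat_eq_0_imp by blast

lemma not_nonpos_Int_plus_1: "c \<notin> \<int>\<^sub>\<le>\<^sub>0 \<Longrightarrow> c + 1 \<notin> (\<int>\<^sub>\<le>\<^sub>0 :: complex set)"
  using plus_one_in_nonpos_Ints_imp by blast

lemma of_nat_add_divide_LIMSEQ_1:
  "(\<lambda>n. (z + of_nat n) / (w + of_nat n)) \<longlonglongrightarrow> (1 :: complex)"
proof -
  have lim: "(\<lambda>n. u / of_nat n) \<longlonglongrightarrow> 0" for u :: complex
    by (rule tendsto_divide_0[OF tendsto_const tendsto_of_nat])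
  have "(\<lambda>n. (z / of_nat n + 1) / (w / of_nat n + 1)) \<longlonglongrightarrow> (0 + 1) / (0 + 1)"
    by (intro tendsto_intros lim) auto
  moreover have "eventually (\<lambda>n. (z / of_nat n + 1) / (w / of_nat n + 1) =
      (z + of_nat n) / (w + of_nat n)) sequentially"
    using eventually_gt_at_top[of 0]
  proof eventually_elim
    case (elim n)
    have "z / of_nat n + 1 = (z + of_nat n) / of_nat n" "w / of_nat n + 1 = (w + of_nat n) / of_nat n"
      using elim by (auto simp: field_simps)
    thus ?case using elim by simp
  qed
  ultimately show ?thesis by (simp add: tendsto_cong)
qed

text \<open>Ratio test: the quotient of consecutive terms tends to \<open>norm z\<close> and is
  therefore eventually below the midpoint of \<open>norm z\<close> and 1.\<close>

lemma summable_norm_hyp_coeff_power: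
  assumes "norm z < 1"
  shows "summable (\<lambda>n. norm (hyp_coeff a b c n * z ^ n))"
proof -
  define q where "q = (\<lambda>n. ((a + of_nat n) / (c + of_nat n)) * ((b + of_nat n) / (1 + of_nat n)))"
  have "(\<lambda>n. norm (q n) * norm z) \<longlonglongrightarrow> norm (1 * 1 :: complex) * norm z"
    unfolding q_def by (intro tendsto_intros of_nat_add_divide_LIMSEQ_1)
  moreover have "norm z < (1 + norm z) / 2" using assms by simp
  ultimately have "eventually (\<lambda>n. norm (q n) * norm z < (1 + norm z) / 2) sequentially"
    by (intro order_tendstoD) auto
  then obtain N where N: "\<And>n. n \<ge> N \<Longrightarrow> norm (q n) * norm z < (1 + norm z) / 2"
    by (auto simp: eventually_sequentially)
  show ?thesis
  proof (rule summable_ratio_test)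
    show "(1 + norm z) / 2 < 1" using assms by simp
    fix n assume "n \<ge> N"
    have "norm (hyp_coeff a b c (Suc n) * z ^ Suc n) = norm (hyp_coeff a b c n * z ^ n) * (norm (q n) * norm z)"
      by (simp add: hyp_coeff_Suc q_def norm_mult norm_divide norm_power mult_ac add_ac)
    also have "\<dots> \<le> norm (hyp_coeff a b c n * z ^ n) * ((1 + norm z) / 2)"
      using N[OF \<open>n \<ge> N\<close>] by (intro mult_left_mono) auto
    finally show "norm (norm (hyp_coeff a b c (Suc n) * z ^ Suc n)) \<le>
        (1 + norm z) / 2 * norm (norm (hyp_coeff a b c n * z ^ n))"
      by (simp add: mult.commute)
  qed
qed

text \<open>The coefficient of index \<open>Suc n\<close> is a product of three convergent Gamma
  sequences times n to the power \<open>a + b - c\<close>, divided by n + 1. The index is shifted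
  because \<open>Gamma_series\<close> at \<open>n\<close> contains a Pochhammer symbol with n + 1
  factors.\<close>

lemma hyp_coeff_Suc_bound:
  obtains K where "K > 0"
    "\<And>n. n \<ge> 1 \<Longrightarrow> norm (hyp_coeff a b c (Suc n)) \<le> K * real n powr (Re (a + b - c) - 1)"
proof -
  define g where "g = (\<lambda>n. rGamma_series a n * rGamma_series b n * Gamma_series c n)"
  have "g \<longlonglongrightarrow> rGamma a * rGamma b * Gamma c"
    unfolding g_def by (intro tendsto_intros)
  hence "Bseq g" using convergent_def convergent_imp_Bseq by blast
  then obtain K where K: "K > 0" "\<And>n. norm (g n) \<le> K" by (auto simp: Bseq_def)
  show ?thesis
  proof (rule that[OF K(1)])
    fix n :: nat assume n: "n \<ge> 1"
    have "hyp_coeff a b c (Suc n) = g n * exp ((a + b - c) * of_real (ln (of_nat n))) * (1 / of_nat (Suc n))"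
      by (simp add: hyp_coeff_def g_def rGamma_series_def Gamma_series_def algebra_simps exp_add exp_diff
                    divide_simps del: of_nat_Suc)
    also have "norm \<dots> \<le> K * real n powr Re (a + b - c) * (1 / real n)"
      unfolding norm_mult
    proof (intro mult_mono)
      show "norm (exp ((a + b - c) * complex_of_real (ln (real n)))) \<le> real n powr Re (a + b - c)"
        using n by (simp add: powr_def)
      show "norm (1 / of_nat (Suc n) :: complex) \<le> 1 / real n"
        using n by (simp add: norm_divide frac_le del: of_nat_Suc)
    qed (use K in auto)
    also have "\<dots> = K * real n powr (Re (a + b - c) - 1)"
      using n by (simp add: powr_diff)
    finally show "norm (hyp_coeff a b c (Suc n)) \<le> K * real n powr (Re (a + b - c) - 1)" .
  qed
qed

lemma summable_norm_hyp_coeff: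
  assumes "Re (c - a - b) > 0"
  shows "summable (\<lambda>n. norm (hyp_coeff a b c n))"
proof -
  obtain K where K: "K > 0"
      "\<And>n. n \<ge> 1 \<Longrightarrow> norm (hyp_coeff a b c (Suc n)) \<le> K * real n powr (Re (a + b - c) - 1)"
    using hyp_coeff_Suc_bound[of a b c] by blast
  have "summable (\<lambda>n. K * real n powr (Re (a + b - c) - 1))"
    using assms by (intro summable_mult) (simp add: summable_real_powr_iff)
  hence "summable (\<lambda>n. norm (hyp_coeff a b c (Suc n)))"
    by (rule summable_comparison_test'[where N = 1]) (use K in auto)
  thus ?thesis by (rule summable_Suc_iff[THEN iffD1])
qed

text \<open>Supplies the vanishing boundary term of the telescoping sum in the contiguous relation
  that follows.\<close>

lemma of_nat_mult_hyp_coeff_LIMSEQ_0: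
  assumes "Re (c - a - b) > 0"
  shows "(\<lambda>n. of_nat n * hyp_coeff a b c n) \<longlonglongrightarrow> 0"
proof -
  obtain K where K: "K > 0"
      "\<And>n. n \<ge> 1 \<Longrightarrow> norm (hyp_coeff a b c (Suc n)) \<le> K * real n powr (Re (a + b - c) - 1)"
    using hyp_coeff_Suc_bound[of a b c] by blast
  have "(\<lambda>n. of_nat (Suc n) * hyp_coeff a b c (Suc n)) \<longlonglongrightarrow> 0"
  proof (rule Lim_null_comparison)
    show "eventually (\<lambda>n. norm (of_nat (Suc n) * hyp_coeff a b c (Suc n)) \<le>
        2 * K * real n powr (Re (a + b - c))) sequentially"
      using eventually_ge_at_top[of 1]
    proof eventually_elim
      case (elim n)
      have "norm (of_nat (Suc n) * hyp_coeff a b c (Suc n)) \<le>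
          (2 * real n) * (K * real n powr (Re (a + b - c) - 1))"
        unfolding norm_mult norm_of_nat using elim K by (intro mult_mono) auto
      also have "\<dots> = 2 * K * real n powr (Re (a + b - c))"
        using elim by (simp add: powr_diff)
      finally show ?case .
    qed
    have "(\<lambda>n. real n powr (Re (a + b - c))) \<longlonglongrightarrow> 0"
      using assms by (intro tendsto_neg_powr filterlim_real_sequentially) auto
    from tendsto_mult_right_zero[OF this]
    show "(\<lambda>n. 2 * K * real n powr (Re (a + b - c))) \<longlonglongrightarrow> 0" .
  qed
  thus ?thesis by (rule LIMSEQ_imp_Suc)
qed

text \<open>Subtracted term by term, the two sides differ by c times a telescoping difference of
  \<open>of_nat n * u n\<close>, which starts at 0 and tends to 0.\<close>

lemma hyp_coeff_suminf_contiguous: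
  assumes c: "Re c > 0" and cab: "Re (c - a - b) > 0"
  shows "c * (c - a - b) * suminf (hyp_coeff a b c) =
           (c - a) * (c - b) * suminf (hyp_coeff a b (c + 1))"
proof -
  define u where "u = hyp_coeff a b c"
  define v where "v = hyp_coeff a b (c + 1)"
  have nz: "c + of_nat n \<noteq> 0" for n
    using not_nonpos_Int_add_of_nat pos_Re_not_nonpos_Int c by blast
  have v: "v n = u n * (c / (c + of_nat n))" for n
  proof -
    have "c * pochhammer (c + 1) n = pochhammer c n * (c + of_nat n)"
      by (metis pochhammer_Suc pochhammer_rec)
    moreover have "c \<noteq> 0" using c by auto
    ultimately have "pochhammer (c + 1) n = pochhammer c n * (c + of_nat n) / c"
      by (simp add: field_simps)
    thus ?thesis by (simp add: u_def v_def hyp_coeff_def)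
  qed
  have key: "c * (c - a - b) * u n - (c - a) * (c - b) * v n =
               c * (of_nat n * u n - of_nat (Suc n) * u (Suc n))" for n
  proof -
    have *: "of_nat (Suc n) * u (Suc n) = u n * ((a + of_nat n) * (b + of_nat n) / (c + of_nat n))"
      using of_nat_neq_0[of n] unfolding u_def hyp_coeff_Suc by (simp del: of_nat_Suc)
    show ?thesis unfolding v * using nz[of n]
      by (simp add: divide_simps) (simp add: algebra_simps)
  qed
  have "(\<lambda>n. c * (of_nat n * u n - of_nat (Suc n) * u (Suc n))) sums (c * (of_nat 0 * u 0 - 0))"
    by (intro sums_mult telescope_sums') (unfold u_def, rule of_nat_mult_hyp_coeff_LIMSEQ_0[OF cab])
  hence 1: "(\<lambda>n. c * (c - a - b) * u n - (c - a) * (c - b) * v n) sums 0"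
    unfolding key by simp
  have "summable u" "summable v"
    unfolding u_def v_def using cab by (auto intro!: summable_norm_cancel[OF summable_norm_hyp_coeff])
  hence "(\<lambda>n. c * (c - a - b) * u n - (c - a) * (c - b) * v n) sums
      (c * (c - a - b) * suminf u - (c - a) * (c - b) * suminf v)"
    by (intro sums_diff sums_mult summable_sums)
  from sums_unique2[OF this 1] show ?thesis by (simp add: u_def v_def)
qed

text \<open>Iterating the contiguous relation moves \<open>c\<close> to c + m. As m grows, the
  Pochhammer quotients tend to the Gamma factors and the shifted series tends to its constant term
  1. Using \<open>rGamma\<close> for two of the factors covers their zeros.\<close>

theorem Gauss_hyp_sums:
  assumes c: "Re c > 0" and cab: "Re (c - a - b) > 0"
  shows "hyp_coeff a b c sums (Gamma c * Gamma (c - a - b) * rGamma (c - a) * rGamma (c - b))"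
proof -
  define S where "S = (\<lambda>c. suminf (hyp_coeff a b c))"
  have iter: "pochhammer c m * pochhammer (c - a - b) m * S c =
      pochhammer (c - a) m * pochhammer (c - b) m * S (c + of_nat m)" for m
  proof (induction m)
    case (Suc m)
    have "Re (c + of_nat m) > 0" "Re (c + of_nat m - a - b) > 0" using c cab by auto
    from hyp_coeff_suminf_contiguous[OF this]
    have rec: "(c + of_nat m) * (c - a - b + of_nat m) * S (c + of_nat m) =
       (c - a + of_nat m) * (c - b + of_nat m) * S (c + of_nat (Suc m))"
      by (simp add: S_def algebra_simps)
    have "pochhammer c (Suc m) * pochhammer (c - a - b) (Suc m) * S c =
        (pochhammer c m * pochhammer (c - a - b) m * S c) * ((c + of_nat m) * (c - a - b + of_nat m))"
      by (simp add: pochhammer_Suc)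
    also have "\<dots> = pochhammer (c - a) m * pochhammer (c - b) m *
        ((c + of_nat m) * (c - a - b + of_nat m) * S (c + of_nat m))"
      unfolding Suc.IH by simp
    also have "\<dots> = pochhammer (c - a) (Suc m) * pochhammer (c - b) (Suc m) * S (c + of_nat (Suc m))"
      unfolding rec by (simp add: pochhammer_Suc)
    finally show ?case .
  qed simp
  \<comment> \<open>In this product the factorials and the powers of m cancel, because c + (c - a -
    b) = (c - a) + (c - b). What remains is the Pochhammer quotient of order m + 1.\<close>
  define X where "X = (\<lambda>m. Gamma_series c m * Gamma_series (c - a - b) m *
      rGamma_series (c - a) m * rGamma_series (c - b) m)"
  have X: "S c = X m * S (c + of_nat (Suc m))" for m
  proof -
    have "pochhammer c (Suc m) \<noteq> 0" "pochhammer (c - a - b) (Suc m) \<noteq> 0"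
      using c cab pos_Re_not_nonpos_Int pochhammer_eq_0_imp_nonpos_Int by blast+
    hence "S c = pochhammer (c - a) (Suc m) * pochhammer (c - b) (Suc m) /
        (pochhammer c (Suc m) * pochhammer (c - a - b) (Suc m)) * S (c + of_nat (Suc m))"
      using iter[of "Suc m"] by (simp add: field_simps del: of_nat_Suc)
    also have "pochhammer (c - a) (Suc m) * pochhammer (c - b) (Suc m) /
        (pochhammer c (Suc m) * pochhammer (c - a - b) (Suc m)) = X m"
      by (simp add: X_def Gamma_series_def rGamma_series_def divide_simps exp_diff exp_add algebra_simps)
    finally show ?thesis .
  qed
  \<comment> \<open>Tannery's theorem with the series for m = 0 as majorant: since Re c is positive,
    each factor c + i only grows in norm when m is added.\<close>
  have "(\<lambda>m. \<Sum>n. hyp_coeff a b (c + of_nat m) n) \<longlonglongrightarrow> (\<Sum>n. if n = 0 then 1 else 0)"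
  proof (rule tannerys_theorem[THEN conjunct2, THEN conjunct2])
    show "summable (\<lambda>n. norm (hyp_coeff a b c n))" by (rule summable_norm_hyp_coeff[OF cab])
    have "norm (hyp_coeff a b (c + of_nat m) n) \<le> norm (hyp_coeff a b c n)" for m n
    proof -
      have "norm (pochhammer c n) \<le> norm (pochhammer (c + of_nat m) n)"
        unfolding pochhammer_prod prod_norm [symmetric]
      proof (intro prod_mono conjI)
        fix i
        show "norm (c + of_nat i) \<le> norm (c + of_nat m + of_nat i)"
          using c by (auto simp: cmod_def intro!: power_mono)
      qed auto
      moreover have "pochhammer c n \<noteq> 0"
        using c pos_Re_not_nonpos_Int pochhammer_eq_0_imp_nonpos_Int by blast
      ultimately show ?thesis
        unfolding hyp_coeff_def norm_divide norm_mult
        by (intro divide_left_mono mult_right_mono mult_pos_pos) (auto intro: order.strict_trans2)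
    qed
    thus "eventually (\<lambda>(n, m). norm (hyp_coeff a b (c + of_nat m) n) \<le> norm (hyp_coeff a b c n))
            (at_top \<times>\<^sub>F sequentially)"
      by (intro always_eventually) auto
    show "(\<lambda>m. hyp_coeff a b (c + of_nat m) n) \<longlonglongrightarrow> (if n = 0 then 1 else 0)" for n
    proof (cases n)
      case (Suc k)
      have "filterlim (\<lambda>m. c + of_nat i + of_nat m) at_infinity sequentially" for i
        by (intro tendsto_add_filterlim_at_infinity[OF tendsto_const] tendsto_of_nat)
      hence lim: "(\<lambda>m. 1 / (c + of_nat i + of_nat m)) \<longlonglongrightarrow> 0" for i
        by (intro tendsto_divide_0[OF tendsto_const])
      have "(\<lambda>m. \<Prod>i<Suc k. 1 / (c + of_nat i + of_nat m)) \<longlonglongrightarrow> (\<Prod>i<Suc k. 0)"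
        by (intro tendsto_prod lim)
      hence "(\<lambda>m. pochhammer a n * pochhammer b n / fact n *
            (\<Prod>i<Suc k. 1 / (c + of_nat i + of_nat m))) \<longlonglongrightarrow> 0"
        by (intro tendsto_mult_right_zero) (simp del: prod.lessThan_Suc)
      moreover have "(\<lambda>m. hyp_coeff a b (c + of_nat m) n) =
           (\<lambda>m. pochhammer a n * pochhammer b n / fact n * (\<Prod>i<Suc k. 1 / (c + of_nat i + of_nat m)))"
        unfolding hyp_coeff_def Suc pochhammer_prod prod_dividef atLeast0LessThan
        by (simp add: add_ac mult_ac)
      ultimately show ?thesis by (simp add: Suc)
    qed simp
  qed auto
  hence "(\<lambda>m. S (c + of_nat m)) \<longlonglongrightarrow> 1"
    using suminf_finite[of "{0}" "\<lambda>n. if n = 0 then 1 else 0 :: complex"] by (simp add: S_def)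
  hence "(\<lambda>m. S (c + of_nat (Suc m))) \<longlonglongrightarrow> 1" by (rule LIMSEQ_Suc)
  moreover have "X \<longlonglongrightarrow> Gamma c * Gamma (c - a - b) * rGamma (c - a) * rGamma (c - b)"
    unfolding X_def by (intro tendsto_intros)
  ultimately have "(\<lambda>m. X m * S (c + of_nat (Suc m))) \<longlonglongrightarrow>
      Gamma c * Gamma (c - a - b) * rGamma (c - a) * rGamma (c - b) * 1"
    by (intro tendsto_mult)
  hence "(\<lambda>m. S c) \<longlonglongrightarrow> Gamma c * Gamma (c - a - b) * rGamma (c - a) * rGamma (c - b)"
    using X by simp
  hence "S c = Gamma c * Gamma (c - a - b) * rGamma (c - a) * rGamma (c - b)"
    using LIMSEQ_unique tendsto_const by blast
  thus ?thesis
    using summable_sums[OF summable_norm_cancel[OF summable_norm_hyp_coeff[OF cab]]] by (simp add: S_def)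
qed

section \<open>The Beta integral over the half-line\<close>

lemma norm_of_real_powr:
  "t > 0 \<Longrightarrow> norm (complex_of_real t powr z) = t powr Re z"
  by (simp add: norm_powr_real_powr)

text \<open>On the real axis \<open>Ln\<close> is \<open>ln\<close> of the absolute value, plus i pi
  on the negative half-line, so the power is piecewise built from measurable real functions; at 0 it
  is 0 by the convention for \<open>powr\<close>.\<close>

lemma measurable_of_real_powr [measurable]:
  "(\<lambda>t. complex_of_real t powr z) \<in> borel_measurable borel"
proof -
  have "(\<lambda>t. complex_of_real t powr z) =
          (\<lambda>t. if t = 0 then 0 else exp (z * (of_real (ln \<bar>t\<bar>) + (if t < 0 then of_real pi * \<i> else 0))))"
    by (auto simp: fun_eq_iff powr_def Ln_of_real Ln_of_real' split: if_splits)
  also have "\<dots> \<in> borel_measurable borel"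
    by measurable
  finally show ?thesis .
qed

lemma integrable_mult_left_cancel:
  fixes f :: "'a \<Rightarrow> complex"
  assumes "c \<noteq> 0" "integrable M (\<lambda>x. c * f x)"
  shows "integrable M f"
proof -
  have "(\<lambda>x. inverse c * (c * f x)) = f" using assms(1) by (simp add: fun_eq_iff field_simps)
  thus ?thesis using integrable_mult_right[of "inverse c", OF assms(2)] by simp
qed

text \<open>Euler's integral for \<open>Gamma\<close>, moved from \<open>lebesgue\<close> to
  \<open>lborel\<close> and rescaled by the substitution of \<open>v * t\<close> for
  \<open>t\<close>.\<close>

lemma set_integral_Gamma_scaled:
  assumes z: "Re z > 0" and v: "v > (0::real)"
  shows "set_integrable lborel {0<..} (\<lambda>t. complex_of_real t powr (z - 1) * exp (- of_real (v * t)))"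
    and "(LINT t:{0<..}|lborel. complex_of_real t powr (z - 1) * exp (- of_real (v * t))) =
           Gamma z * of_real v powr (-z)"
proof -
  define f where "f = (\<lambda>t. indicator {0<..} t *\<^sub>R (complex_of_real t powr (z - 1) * exp (- of_real t)))"
  have eq: "complex_of_real t powr (z - 1) / of_real (exp t) =
            complex_of_real t powr (z - 1) * exp (- of_real t)" for t
    by (simp add: exp_minus exp_of_real field_simps)
  have meas: "(\<lambda>t. indicator {0<..} t *\<^sub>R (complex_of_real t powr (z - 1) * exp (- of_real t))) 
     \<in> borel_measurable borel"
    by measurable
  have ai: "set_integrable lebesgue {0<..} (\<lambda>t. complex_of_real t powr (z - 1) * exp (- of_real t))"
    using absolutely_integrable_Gamma_integral'[OF z] unfolding eq by simp
  have int: "integrable lborel f"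
    using ai integrable_completion[of f lborel] meas unfolding set_integrable_def f_def by simp
  have "(LINT t:{0<..}|lebesgue. complex_of_real t powr (z - 1) * exp (- of_real t)) = Gamma z"
    using has_integral_set_lebesgue[OF ai] Gamma_integral_complex'[OF z] unfolding eq
    by (rule has_integral_unique)
  hence val: "integral\<^sup>L lborel f = Gamma z"
    using meas integral_completion[of f lborel] unfolding set_lebesgue_integral_def f_def by simp
  have fv: "f (v * t) = of_real v powr (z - 1) * indicator {0<..} t *\<^sub>R
         (complex_of_real t powr (z - 1) * exp (- of_real (v * t)))" for t
  proof (cases "t > 0")
    case True
    hence "complex_of_real (v * t) powr (z - 1) = of_real v powr (z - 1) * of_real t powr (z - 1)"
      using v by (simp add: powr_times_real)
    thus ?thesis using True v by (simp add: f_def)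
  qed (use v in \<open>auto simp: f_def indicator_def zero_less_mult_iff\<close>)
  have vnz: "complex_of_real v powr (z - 1) \<noteq> 0" using v by simp
  have "integrable lborel (\<lambda>t. f (0 + v * t))"
    using v int by (intro lborel_integrable_real_affine) auto
  hence "integrable lborel (\<lambda>t. of_real v powr (z - 1) * (indicator {0<..} t *\<^sub>R
         (complex_of_real t powr (z - 1) * exp (- of_real (v * t)))))"
    by (simp only: fv add_0)
  from integrable_mult_left_cancel[OF vnz this]
  show "set_integrable lborel {0<..} (\<lambda>t. complex_of_real t powr (z - 1) * exp (- of_real (v * t)))"
    by (simp only: set_integrable_def)
  have "integral\<^sup>L lborel f = \<bar>v\<bar> *\<^sub>R integral\<^sup>L lborel (\<lambda>t. f (0 + v * t))"
    using v by (intro lborel_integral_real_affine) auto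
  also have "\<dots> = of_real v * of_real v powr (z - 1) * 
      (LINT t:{0<..}|lborel. complex_of_real t powr (z - 1) * exp (- of_real (v * t)))"
    using v unfolding set_lebesgue_integral_def by (simp add: fv scaleR_conv_of_real)
  also have "of_real v * of_real v powr (z - 1) = of_real v powr z"
    using v by (simp add: powr_diff)
  finally show "(LINT t:{0<..}|lborel. complex_of_real t powr (z - 1) * exp (- of_real (v * t))) =
           Gamma z * of_real v powr (-z)"
    using v val by (simp add: powr_minus field_simps)
qed


text \<open>Fubini for one function of two variables: integrating out t leaves Gamma p times Euler's
  integral for q, while integrating out v leaves Gamma (p + q) times the Beta integrand.\<close>

lemma set_integral_Beta_half_line:
  assumes p: "Re p > 0" and q: "Re q > 0"
  shows "set_integrable lborel {0<..} (\<lambda>t. complex_of_real t powr (p - 1) * of_real (1 + t) powr (-(p + q)))"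
    and "(LINT t:{0<..}|lborel. complex_of_real t powr (p - 1) * of_real (1 + t) powr (-(p + q))) =
           Gamma p * Gamma q / Gamma (p + q)"
proof -
  define f where "f = (\<lambda>(v::real, t::real). indicator {0<..} v *\<^sub>R indicator {0<..} t *\<^sub>R
      (complex_of_real v powr (p + q - 1) * exp (- of_real v) *
       (complex_of_real t powr (p - 1) * exp (- of_real (v * t)))))"
  \<comment> \<open>Two groupings of the same integrand: \<open>fv\<close> isolates the factor
    depending on t for fixed v, and \<open>ft\<close> the factor depending on v for fixed t, where
    the exponentials merge into one with rate 1 + t.\<close>
  have fv: "f (v, t) = (indicator {0<..} v *\<^sub>R (complex_of_real v powr (p + q - 1) * exp (- of_real v))) *
      (indicator {0<..} t *\<^sub>R (complex_of_real t powr (p - 1) * exp (- of_real (v * t))))" for v t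
    by (simp add: f_def)
  have ft: "f (v, t) = (indicator {0<..} t *\<^sub>R complex_of_real t powr (p - 1)) *
      (indicator {0<..} v *\<^sub>R (complex_of_real v powr (p + q - 1) * exp (- of_real ((1 + t) * v))))" for v t
    by (simp add: f_def indicator_def exp_add exp_diff exp_minus field_simps)
  have inner_v: "(LINT t|lborel. f (v, t)) =
      Gamma p * (indicator {0<..} v *\<^sub>R (complex_of_real v powr (q - 1) * exp (- of_real (1 * v))))" for v
  proof (cases "v > 0")
    case True
    have "(LINT t|lborel. f (v, t)) =
        (complex_of_real v powr (p + q - 1) * exp (- of_real v)) * (Gamma p * of_real v powr (-p))"
      using set_integral_Gamma_scaled(2)[OF p True] True
      unfolding set_lebesgue_integral_def by (simp add: fv del: mult_scaleR_right)
    also have "\<dots> = Gamma p * ((complex_of_real v powr (p + q - 1) * of_real v powr (-p)) * exp (- of_real v))"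
      by simp
    also have "complex_of_real v powr (p + q - 1) * of_real v powr (-p) = of_real v powr (q - 1)"
      by (subst powr_add [symmetric]) (simp add: algebra_simps)
    finally show ?thesis using True by simp
  qed (simp add: f_def)
  have inner_t: "(LINT v|lborel. f (v, t)) = Gamma (p + q) *
      (indicator {0<..} t *\<^sub>R (complex_of_real t powr (p - 1) * of_real (1 + t) powr (-(p + q))))" for t
  proof (cases "t > 0")
    case True
    hence "1 + t > 0" "Re (p + q) > 0" using p q by auto
    from set_integral_Gamma_scaled(2)[OF this(2,1)] True show ?thesis
      unfolding set_lebesgue_integral_def by (simp add: ft del: mult_scaleR_right mult_scaleR_left)
  qed (simp add: f_def)
  have norm_inner: "(LINT t|lborel. norm (f (v, t))) =
      Gamma (Re p) * norm (indicator {0<..} v *\<^sub>R (complex_of_real v powr (q - 1) * exp (- of_real (1 * v))))" for v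
  proof (cases "v > 0")
    case True
    \<comment> \<open>The norm of the integrand is a Gamma integrand with the real exponent Re p, so
      the complex formula evaluates the integral of the norm as well.\<close>
    define P where "P = complex_of_real (Re p)"
    have P: "Re P > 0" using p by (simp add: P_def)
    have "(LINT t|lborel. norm (f (v, t))) =
        (LINT t|lborel. norm (complex_of_real v powr (p + q - 1) * exp (- of_real v)) *
           Re (indicator {0<..} t *\<^sub>R (complex_of_real t powr (P - 1) * exp (- of_real (v * t)))))"
    proof (intro Bochner_Integration.integral_cong refl)
      fix t :: real
      show "norm (f (v, t)) = norm (complex_of_real v powr (p + q - 1) * exp (- of_real v)) *
           Re (indicator {0<..} t *\<^sub>R (complex_of_real t powr (P - 1) * exp (- of_real (v * t))))"
      proof (cases "t > 0")
        case t: True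
        have "complex_of_real t powr (P - 1) * exp (- of_real (v * t)) =
            of_real (t powr (Re p - 1) * exp (- (v * t)))"
          using t powr_of_real[of t "Re p - 1"] exp_of_real[of "- (v * t)", where 'a = complex]
          by (simp add: P_def)
        hence "Re (complex_of_real t powr (P - 1) * exp (- of_real (v * t))) =
            norm (complex_of_real t powr (p - 1) * exp (- of_real (v * t)))"
          using t by (simp add: norm_mult norm_of_real_powr del: of_real_mult)
        thus ?thesis using True t by (simp add: fv norm_mult del: of_real_mult)
      qed (simp add: fv)
    qed
    also have "\<dots> = norm (complex_of_real v powr (p + q - 1) * exp (- of_real v)) *
           Re (Gamma P * of_real v powr (-P))"
      using set_integral_Gamma_scaled[OF P True]
      unfolding set_lebesgue_integral_def set_integrable_def
      by (simp only: integral_mult_right_zero integral_Re)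
    also have "Re (Gamma P * of_real v powr (-P)) = Gamma (Re p) * v powr (-Re p)"
      using True powr_of_real[of v "-Re p"] by (simp add: P_def Gamma_complex_of_real)
    also have "norm (complex_of_real v powr (p + q - 1) * exp (- of_real v)) * (Gamma (Re p) * v powr (-Re p)) =
        Gamma (Re p) * ((v powr (Re (p + q - 1)) * v powr (-Re p)) * norm (exp (- complex_of_real v)))"
      using True by (simp add: norm_mult norm_of_real_powr)
    also have "v powr (Re (p + q - 1)) * v powr (-Re p) = v powr Re (q - 1)"
      by (subst powr_add [symmetric]) simp
    finally show ?thesis using True by (simp add: norm_mult norm_of_real_powr P_def Gamma_complex_of_real)
  qed (simp add: f_def)
  have meas [measurable]: "f \<in> borel_measurable (lborel \<Otimes>\<^sub>M lborel)"
    unfolding f_def by measurable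
  have "integrable (lborel \<Otimes>\<^sub>M lborel) f"
  proof (rule lborel_pair.Fubini_integrable)
    show "integrable lborel (\<lambda>v. LINT t|lborel. norm (f (v, t)))"
      unfolding norm_inner
      using set_integral_Gamma_scaled(1)[OF q, of 1] unfolding set_integrable_def
      by (intro integrable_mult_right integrable_norm) auto
    show "AE v in lborel. integrable lborel (\<lambda>t. f (v, t))"
    proof (rule AE_I2)
      fix v :: real
      show "integrable lborel (\<lambda>t. f (v, t))"
      proof (cases "v > 0")
        case True
        from set_integral_Gamma_scaled(1)[OF p this] show ?thesis
          unfolding fv set_integrable_def by (intro integrable_mult_right)
      qed (simp add: f_def)
    qed
  qed simp
  hence f: "integrable (lborel \<Otimes>\<^sub>M lborel) (case_prod (\<lambda>v t. f (v, t)))"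
    by simp
  have G: "Gamma (p + q) \<noteq> 0"
    using p q pos_Re_not_nonpos_Int[of "p + q"] by (simp add: Gamma_eq_zero_iff)
  \<comment> \<open>Integrability of the Beta integrand is inherited from the double integral: it is
    a marginal divided by the nonzero constant \<open>Gamma (p + q)\<close>.\<close>
  have "integrable lborel (\<lambda>t. Gamma (p + q) *
      (indicator {0<..} t *\<^sub>R (complex_of_real t powr (p - 1) * of_real (1 + t) powr (-(p + q)))))"
    using lborel_pair.integrable_snd[OF f] by (simp only: inner_t)
  from integrable_mult_left_cancel[OF G this]
  show "set_integrable lborel {0<..} (\<lambda>t. complex_of_real t powr (p - 1) * of_real (1 + t) powr (-(p + q)))"
    by (simp only: set_integrable_def)
  have "Gamma (p + q) * (LINT t:{0<..}|lborel. complex_of_real t powr (p - 1) * of_real (1 + t) powr (-(p + q)))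
      = Gamma p * (LINT v:{0<..}|lborel. complex_of_real v powr (q - 1) * exp (- of_real (1 * v)))"
    using lborel_pair.Fubini_integral[OF f]
    by (simp only: inner_t inner_v set_lebesgue_integral_def integral_mult_right_zero)
  also have "\<dots> = Gamma p * Gamma q"
    using set_integral_Gamma_scaled(2)[OF q, of 1] by simp
  finally show "(LINT t:{0<..}|lborel. complex_of_real t powr (p - 1) * of_real (1 + t) powr (-(p + q))) =
           Gamma p * Gamma q / Gamma (p + q)"
    using G by (simp add: field_simps)
qed

section \<open>The integral at \<open>z = 0\<close>\<close>

text \<open>Pfaff's transform of \<open>F(a,b;c;-t)\<close>, which needs no analytic continuation.\<close>
definition hyp_neg :: "complex \<Rightarrow> complex \<Rightarrow> complex \<Rightarrow> real \<Rightarrow> complex" where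
  "hyp_neg a b c t = of_real (1 + t) powr (-a) *
     (\<Sum>n. hyp_coeff a (c - b) c n * of_real (t / (1 + t)) ^ n)"

text \<open>The Gamma ratio is a constant times (p)_n / (r)_n, which is itself a hypergeometric
  coefficient with second upper parameter 1. Both factors then obey
  \<open>hyp_coeff_Suc_bound\<close>, and the exponents add up to less than -1.\<close>

lemma summable_hyp_coeff_times_Gamma_ratio:
  assumes p: "p > 0" and r: "r > 0" and e: "Re (a + b - c) + p - r < 0"
  shows "summable (\<lambda>n. norm (hyp_coeff a b c n) * (Gamma (p + real n) / Gamma (r + real n)))"
proof -
  define x where "x = hyp_coeff (complex_of_real p) 1 (complex_of_real r)"
  have ratio: "Gamma (p + real n) / Gamma (r + real n) = Gamma p / Gamma r * norm (x n)" for n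
  proof -
    have pr: "p \<notin> \<int>\<^sub>\<le>\<^sub>0" "r \<notin> \<int>\<^sub>\<le>\<^sub>0" using p r by (auto elim!: nonpos_Ints_cases)
    have G: "Gamma p \<noteq> 0" "Gamma r \<noteq> 0" using pr by (simp_all add: Gamma_eq_zero_iff)
    have "x n = pochhammer p n / pochhammer r n"
      by (simp add: x_def hyp_coeff_def pochhammer_of_real flip: pochhammer_fact)
    hence "norm (x n) = pochhammer p n / pochhammer r n"
      using p r by (simp add: norm_divide pochhammer_pos less_imp_le)
    thus ?thesis using G by (simp add: pochhammer_Gamma pr)
  qed
  obtain K where K: "K > 0"
      "\<And>n. n \<ge> 1 \<Longrightarrow> norm (hyp_coeff a b c (Suc n)) \<le> K * real n powr (Re (a + b - c) - 1)"
    using hyp_coeff_Suc_bound[of a b c] by blast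
  obtain L where L: "L > 0"
      "\<And>n. n \<ge> 1 \<Longrightarrow> norm (x (Suc n)) \<le> L * real n powr (Re (of_real p + 1 - of_real r) - 1)"
    using hyp_coeff_Suc_bound[of "of_real p" 1 "of_real r"] unfolding x_def by blast
  have "summable (\<lambda>n. norm (hyp_coeff a b c (Suc n)) * norm (x (Suc n)))"
  proof (rule summable_comparison_test'[where N = 1])
    show "summable (\<lambda>n. K * L * real n powr (Re (a + b - c) + p - r - 1))"
      using e by (intro summable_mult) (simp add: summable_real_powr_iff)
    fix n :: nat assume n: "n \<ge> 1"
    have "norm (hyp_coeff a b c (Suc n)) * norm (x (Suc n)) \<le>
        (K * real n powr (Re (a + b - c) - 1)) * (L * real n powr (Re (of_real p + 1 - of_real r) - 1))"
      using K L n by (intro mult_mono) auto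
    also have "\<dots> = K * L * real n powr (Re (a + b - c) + p - r - 1)"
      by (simp add: algebra_simps flip: powr_add)
    finally show "norm (norm (hyp_coeff a b c (Suc n)) * norm (x (Suc n))) \<le>
        K * L * real n powr (Re (a + b - c) + p - r - 1)" by simp
  qed
  hence "summable (\<lambda>n. norm (hyp_coeff a b c n) * norm (x n))"
    by (rule summable_Suc_iff[THEN iffD1])
  from summable_mult[OF this, of "Gamma p / Gamma r"] show ?thesis
    unfolding ratio by (simp add: mult_ac)
qed

text \<open>The condition on A makes every Beta integral converge; the condition on B makes the
  resulting series at 1 fall under Gauss's theorem.\<close>

lemma set_integral_hyp_neg_one_plus_powr:
  assumes C: "Re C > 0" and A: "Re (A - C + s) > 0" and B: "Re (B - C + s) > 0"
  shows "set_integrable lborel {0<..}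
           (\<lambda>t. complex_of_real t powr (C - 1) * hyp_neg A B C t * of_real (1 + t) powr (-s))"
    and "(LINT t:{0<..}|lborel. complex_of_real t powr (C - 1) * hyp_neg A B C t * of_real (1 + t) powr (-s)) =
           Gamma C * Gamma (A - C + s) * Gamma (B - C + s) * (rGamma (A + B - C + s) * rGamma s)"
proof -
  define k where "k = hyp_coeff A (C - B) C"
  \<comment> \<open>The n-th term of the Pfaff series times the remaining factors, with exponents
    arranged as a Beta integrand for p = C + n and q = A - C + s.\<close>
  define f where "f = (\<lambda>n t. k n * (indicator {0<..} t *\<^sub>R
     (complex_of_real t powr (C + of_nat n - 1) * of_real (1 + t) powr (-(C + of_nat n + (A - C + s))))))"
  define g where "g = (\<lambda>t. complex_of_real t powr (C - 1) * of_real (1 + t) powr (-(A + s)))"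
  have Cn: "Re (C + of_nat n) > 0" for n using C by simp
  have As: "Re (A + s) > 0" using A C by simp
  have f_eq: "f n t = k n * of_real (t / (1 + t)) ^ n * g t" if "t > 0" for n t
  proof -
    have "complex_of_real t powr (C + of_nat n - 1) = of_real t powr (C - 1) * of_real t powr of_nat n"
      by (subst powr_add [symmetric]) (simp add: algebra_simps)
    also have "of_real t powr of_nat n = complex_of_real t ^ n"
      using that by (intro powr_nat') auto
    finally have 1: "complex_of_real t powr (C + of_nat n - 1) = of_real t powr (C - 1) * of_real t ^ n" .
    have "complex_of_real (1 + t) powr (-(C + of_nat n + (A - C + s))) =
        of_real (1 + t) powr (-(A + s)) / of_real (1 + t) powr of_nat n"
      by (subst powr_diff [symmetric]) (simp add: algebra_simps)
    also have "of_real (1 + t) powr of_nat n = complex_of_real (1 + t) ^ n"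
      using that by (intro powr_nat') (simp del: of_real_add)
    finally have 2: "complex_of_real (1 + t) powr (-(C + of_nat n + (A - C + s))) =
        of_real (1 + t) powr (-(A + s)) / of_real (1 + t) ^ n" .
    show ?thesis unfolding f_def g_def 1 2 using that by (simp add: power_divide)
  qed
  have f_0: "f n t = 0" if "\<not> t > 0" for n t using that by (simp add: f_def)
  have int: "integrable lborel (f n)" for n
    using set_integral_Beta_half_line(1)[OF Cn A] unfolding f_def set_integrable_def
    by (intro integrable_mult_right)
  have summable: "summable (\<lambda>n. norm (f n t))" for t
  proof (cases "t > 0")
    case True
    have "norm (complex_of_real (t / (1 + t))) < 1" unfolding norm_of_real using True by simp
    from summable_mult2[OF summable_norm_hyp_coeff_power[OF this, of A "C - B" C], of "norm (g t)"]
    show ?thesis unfolding f_eq[OF True] k_def by (simp add: norm_mult)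
  qed (simp add: f_0)
  have suminf: "(\<Sum>n. f n t) = indicator {0<..} t *\<^sub>R
      (complex_of_real t powr (C - 1) * hyp_neg A B C t * of_real (1 + t) powr (-s))" for t
  proof (cases "t > 0")
    case True
    have "norm (complex_of_real (t / (1 + t))) < 1" unfolding norm_of_real using True by simp
    hence "(\<Sum>n. f n t) = (\<Sum>n. k n * of_real (t / (1 + t)) ^ n) * g t"
      unfolding f_eq[OF True] k_def
      by (intro suminf_mult2 [symmetric] summable_norm_cancel[OF summable_norm_hyp_coeff_power])
    also have "g t = complex_of_real t powr (C - 1) * (of_real (1 + t) powr (-A) * of_real (1 + t) powr (-s))"
      unfolding g_def using powr_add[of "complex_of_real (1 + t)" "-A" "-s"] by simp
    finally show ?thesis using True by (simp add: hyp_neg_def k_def)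
  qed (simp add: f_0)
  \<comment> \<open>Taking norms replaces p and q by their real parts, so the same Beta formula
    applies; the resulting Gamma ratios are those of
    \<open>summable_hyp_coeff_times_Gamma_ratio\<close>.\<close>
  have norm_int: "(LINT t|lborel. norm (f n t)) = Gamma (Re (A - C + s)) *
      (norm (k n) * (Gamma (Re C + real n) / Gamma (Re (A + s) + real n)))" for n
  proof -
    define p where "p = complex_of_real (Re C + real n)"
    define q where "q = complex_of_real (Re (A - C + s))"
    have pq: "Re p > 0" "Re q > 0" using C A by (auto simp: p_def q_def)
    have "(LINT t|lborel. norm (f n t)) = (LINT t|lborel. norm (k n) * 
       Re (indicator {0<..} t *\<^sub>R (complex_of_real t powr (p - 1) * of_real (1 + t) powr (-(p + q)))))"
    proof (intro Bochner_Integration.integral_cong refl)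
      fix t :: real
      show "norm (f n t) = norm (k n) *
        Re (indicator {0<..} t *\<^sub>R (complex_of_real t powr (p - 1) * of_real (1 + t) powr (-(p + q))))"
      proof (cases "t > 0")
        case True
        have "complex_of_real t powr (p - 1) * of_real (1 + t) powr (-(p + q)) =
          of_real (t powr (Re C + real n - 1) * (1 + t) powr (-(Re C + real n + Re (A - C + s))))"
          using True powr_of_real[of t "Re C + real n - 1"]
            powr_of_real[of "1 + t" "-(Re C + real n + Re (A - C + s))"]
          by (simp add: p_def q_def)
        moreover have "norm (f n t) = norm (k n) * (t powr (Re C + real n - 1) *
            (1 + t) powr (-(Re C + real n + Re (A - C + s))))"
          using True unfolding f_def norm_mult by (simp add: norm_mult norm_of_real_powr del: of_real_add)
        ultimately show ?thesis using True by (simp del: of_real_add)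
      qed (simp add: f_def)
    qed
    also have "\<dots> = norm (k n) * Re (Gamma p * Gamma q / Gamma (p + q))"
      using set_integral_Beta_half_line[OF pq]
      unfolding set_lebesgue_integral_def set_integrable_def
      by (simp only: integral_mult_right_zero integral_Re)
    also have "p + q = complex_of_real (Re (A + s) + real n)"
      by (simp add: p_def q_def)
    hence "Gamma p * Gamma q / Gamma (p + q) = complex_of_real
       (Gamma (Re C + real n) * Gamma (Re (A - C + s)) / Gamma (Re (A + s) + real n))"
      unfolding p_def q_def by (simp only: Gamma_complex_of_real of_real_mult of_real_divide)
    finally show ?thesis by simp
  qed
  have sum_int: "summable (\<lambda>n. LINT t|lborel. norm (f n t))"
    unfolding norm_int k_def
    by (intro summable_mult summable_hyp_coeff_times_Gamma_ratio) (use C A B in auto)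
  \<comment> \<open>The Beta value contributes (C)_n / (A + s)_n, which trades the lower parameter C
    of \<open>k n\<close> for A + s.\<close>
  have val: "integral\<^sup>L lborel (f n) =
      hyp_coeff A (C - B) (A + s) n * (Gamma C * Gamma (A - C + s) / Gamma (A + s))" for n
  proof -
    have "integral\<^sup>L lborel (f n) =
        k n * (Gamma (C + of_nat n) * Gamma (A - C + s) / Gamma (A + s + of_nat n))"
      using set_integral_Beta_half_line(2)[OF Cn[of n] A]
      unfolding f_def set_lebesgue_integral_def integral_mult_right_zero by (simp add: add_ac)
    also have "Gamma (C + of_nat n) = pochhammer C n * Gamma C"
      using C by (simp add: pochhammer_Gamma pos_Re_not_nonpos_Int Gamma_eq_zero_iff)
    also have "Gamma (A + s + of_nat n) = pochhammer (A + s) n * Gamma (A + s)"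
      using As pos_Re_not_nonpos_Int[OF As] by (simp add: pochhammer_Gamma Gamma_eq_zero_iff)
    finally show ?thesis
      using pochhammer_eq_0_imp_nonpos_Int[of C n] pos_Re_not_nonpos_Int[OF C]
      by (auto simp: k_def hyp_coeff_def mult_ac)
  qed
  show "set_integrable lborel {0<..}
           (\<lambda>t. complex_of_real t powr (C - 1) * hyp_neg A B C t * of_real (1 + t) powr (-s))"
    using integrable_suminf[OF int _ sum_int] summable unfolding set_integrable_def suminf by simp
  have "(\<lambda>n. integral\<^sup>L lborel (f n)) sums (LINT t|lborel. (\<Sum>n. f n t))"
    by (rule sums_integral[OF int _ sum_int]) (use summable in auto)
  moreover have "(\<lambda>n. integral\<^sup>L lborel (f n)) sums (Gamma (A + s) * Gamma (A + s - A - (C - B)) *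
      rGamma (A + s - A) * rGamma (A + s - (C - B)) * (Gamma C * Gamma (A - C + s) / Gamma (A + s)))"
    unfolding val by (intro sums_mult2 Gauss_hyp_sums) (use As B in auto)
  ultimately have "(LINT t|lborel. (\<Sum>n. f n t)) = Gamma (A + s) * Gamma (A + s - A - (C - B)) *
      rGamma (A + s - A) * rGamma (A + s - (C - B)) * (Gamma C * Gamma (A - C + s) / Gamma (A + s))"
    by (rule sums_unique2)
  moreover have "Gamma (A + s) \<noteq> 0" using pos_Re_not_nonpos_Int[OF As] by (simp add: Gamma_eq_zero_iff)
  ultimately show "(LINT t:{0<..}|lborel. complex_of_real t powr (C - 1) * hyp_neg A B C t * of_real (1 + t) powr (-s)) =
           Gamma C * Gamma (A - C + s) * Gamma (B - C + s) * (rGamma (A + B - C + s) * rGamma s)"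
    unfolding suminf set_lebesgue_integral_def by (simp add: algebra_simps)
qed

section \<open>Dependence of the integral on \<open>z\<close>\<close>

lemma hyp2f1_domain_altdef: "hyp2f1_domain = {z. Im z \<noteq> 0 \<or> Re z < 1}"
proof -
  have "z \<in> complex_of_real ` {1..} \<longleftrightarrow> Im z = 0 \<and> Re z \<ge> 1" for z
    by (auto simp: image_iff complex_eq_iff intro!: bexI[of _ "Re z"])
  thus ?thesis by (auto simp: hyp2f1_domain_def)
qed

lemma open_hyp2f1_domain: "open hyp2f1_domain"
  unfolding hyp2f1_domain_altdef
  by (intro open_Collect_disj open_Collect_neq open_Collect_less continuous_intros)

lemma connected_hyp2f1_domain: "connected hyp2f1_domain"
proof (rule starlike_imp_connected)
  show "starlike hyp2f1_domain"
    unfolding starlike_def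
  proof (intro bexI[of _ 0] ballI subsetI)
    fix z w assume z: "z \<in> hyp2f1_domain" and "w \<in> closed_segment 0 z"
    then obtain u where u: "0 \<le> u" "u \<le> 1" "w = of_real u * z"
      by (auto simp: closed_segment_def scaleR_conv_of_real)
    have "u * Re z < 1" if "Re z < 1"
    proof (cases "Re z \<ge> 0")
      case True
      hence "u * Re z \<le> 1 * Re z" using u by (intro mult_right_mono) auto
      thus ?thesis using that by simp
    next
      case False
      hence "u * Re z \<le> 0" using u by (intro mult_nonneg_nonpos) auto
      thus ?thesis by simp
    qed
    thus "w \<in> hyp2f1_domain" using z u by (auto simp: hyp2f1_domain_altdef)
  qed (simp add: hyp2f1_domain_altdef)
qed

lemma ball_subset_hyp2f1_domain: "ball 0 1 \<subseteq> hyp2f1_domain"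
proof
  fix z :: complex assume "z \<in> ball 0 1"
  hence "Re z < 1" using complex_Re_le_cmod[of z] by simp
  thus "z \<in> hyp2f1_domain" by (simp add: hyp2f1_domain_altdef)
qed

lemma one_minus_plus_notin_nonpos_Reals:
  assumes "z \<in> hyp2f1_domain" "t \<ge> 0"
  shows "1 - z + of_real t \<notin> \<real>\<^sub>\<le>\<^sub>0"
  using assms by (auto simp: hyp2f1_domain_altdef complex_nonpos_Reals_iff)

text \<open>Factor w - h as w times (1 - h / w) and apply the binomial series. Splitting the power
  is legitimate because the whole ball around w avoids the branch cut.\<close>

lemma powr_minus_diff_sums:
  fixes w h s :: complex
  assumes ball: "ball w r \<inter> \<real>\<^sub>\<le>\<^sub>0 = {}" and h: "norm h < r"
  shows "(\<lambda>n. pochhammer s n / fact n * h ^ n * w powr (-(s + of_nat n))) sums (w - h) powr (-s)"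
proof -
  have r: "r > 0" using h norm_ge_zero[of h] by linarith
  \<comment> \<open>The cut contains 0, so the ball misses 0 and \<open>norm w\<close> is at least
    r; this puts h / w inside the unit disc.\<close>
  have "(0::complex) \<in> \<real>\<^sub>\<le>\<^sub>0" by simp
  hence "0 \<notin> ball w r" using ball by blast
  hence w: "norm w \<ge> r" by (simp add: dist_norm)
  hence w0: "w \<noteq> 0" using r by auto
  have quot: "norm (u / w) < 1" if "norm u < r" for u
  proof -
    have "norm w > 0" "norm u < norm w" using that w r by auto
    thus ?thesis by (simp add: norm_divide)
  qed
  \<comment> \<open>\<open>Ln (w - h) = Ln w + Ln (1 - h / w)\<close> because the difference is locally constant in \<open>h\<close>.\<close>
  define \<phi> where "\<phi> = (\<lambda>u. Ln (w - u) - Ln (1 - u / w))"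
  have "\<phi> h = \<phi> 0"
  proof (rule has_field_derivative_zero_constant[of "ball 0 r" \<phi>, THEN exE])
    fix u assume u: "u \<in> ball (0::complex) r"
    have 1: "w - u \<notin> \<real>\<^sub>\<le>\<^sub>0" using ball u by (auto simp: disjoint_iff dist_norm)
    have "Re (u / w) < 1" using quot[of u] u complex_Re_le_cmod[of "u / w"] by simp
    hence 2: "1 - u / w \<notin> \<real>\<^sub>\<le>\<^sub>0" by (auto simp: complex_nonpos_Reals_iff)
    have 3: "w - u \<noteq> 0" "1 - u / w \<noteq> 0" using 1 2 by auto
    have "(\<phi> has_field_derivative (inverse (w - u) * (0 - 1) - inverse (1 - u / w) * (0 - 1 / w))) (at u)"
      unfolding \<phi>_def using 1 2 w0
      by (auto intro!: derivative_eq_intros)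
    also have "inverse (w - u) * (0 - 1) - inverse (1 - u / w) * (0 - 1 / w) = 0"
      using 3 w0 by (simp add: field_simps)
    finally show "(\<phi> has_field_derivative 0) (at u within ball 0 r)"
      by (rule has_field_derivative_at_within)
  next
    fix c assume "\<forall>x\<in>ball 0 r. \<phi> x = c"
    thus "\<phi> h = \<phi> 0" using h r by simp
  qed simp
  hence Ln: "Ln (w - h) = Ln w + Ln (1 - h / w)" by (simp add: \<phi>_def algebra_simps)
  have "w - h \<notin> \<real>\<^sub>\<le>\<^sub>0" using ball h by (auto simp: disjoint_iff dist_norm)
  hence wh: "w - h \<noteq> 0" by auto
  hence wh': "1 - h / w \<noteq> 0" using w0 by (simp add: field_simps)
  have prod: "(w - h) powr (-s) = w powr (-s) * (1 - h / w) powr (-s)"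
    using wh wh' w0 by (simp add: powr_def Ln exp_add [symmetric] algebra_simps)
  have "(\<lambda>n. ((-s) gchoose n) * (-(h / w)) ^ n) sums (1 + (-(h / w))) powr (-s)"
    by (rule gen_binomial_complex) (use quot[OF h] in simp)
  hence "(\<lambda>n. w powr (-s) * (((-s) gchoose n) * (-(h / w)) ^ n)) sums (w powr (-s) * (1 - h / w) powr (-s))"
    by (intro sums_mult) simp
  moreover have "w powr (-s) * (((-s) gchoose n) * (-(h / w)) ^ n) =
      pochhammer s n / fact n * h ^ n * w powr (-(s + of_nat n))" for n
  proof -
    have "w powr (-(s + of_nat n)) = w powr (-s) / w powr of_nat n"
      by (subst powr_diff [symmetric]) simp
    also have "w powr of_nat n = w ^ n" using w0 by (intro powr_nat') auto
    finally have *: "w powr (-(s + of_nat n)) = w powr (-s) / w ^ n" .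
    have "(-(h / w)) ^ n = (-1) ^ n * h ^ n / w ^ n"
      by (simp add: power_minus[of "h / w"] power_divide)
    thus ?thesis unfolding * gbinomial_pochhammer by simp
  qed
  ultimately show ?thesis unfolding prod by simp
qed

text \<open>The argument of w is at most pi in absolute value, which bounds the contribution of
  \<open>Im a\<close>.\<close>

lemma norm_powr_le:
  fixes w a :: complex
  assumes "w \<noteq> 0"
  shows "norm (w powr a) \<le> norm w powr Re a * exp (pi * \<bar>Im a\<bar>)"
proof -
  have "norm (w powr a) = norm w powr Re a * exp (- (Im a * Im (Ln w)))"
    using assms by (simp add: powr_def exp_diff exp_minus field_simps)
  also have "- (Im a * Im (Ln w)) \<le> pi * \<bar>Im a\<bar>"
  proof -
    have "- (Im a * Im (Ln w)) \<le> \<bar>Im a\<bar> * \<bar>Im (Ln w)\<bar>"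
      by (metis abs_ge_minus_self abs_mult)
    also have "\<dots> \<le> \<bar>Im a\<bar> * pi"
      using assms Im_Ln_le_pi[of w] mpi_less_Im_Ln[of w] by (intro mult_left_mono) auto
    finally show ?thesis by (simp add: mult_ac)
  qed
  hence "norm w powr Re a * exp (- (Im a * Im (Ln w))) \<le> norm w powr Re a * exp (pi * \<bar>Im a\<bar>)"
    by (intro mult_left_mono) auto
  finally show ?thesis .
qed

text \<open>For fixed z in the slit plane, 1 - z + t and 1 + t have comparable size uniformly in t.
  Integrability at z = 0 thereby carries over to z.\<close>

lemma powr_one_minus_plus_bound:
  assumes ball: "ball z r \<subseteq> hyp2f1_domain" and r: "r > 0"
  obtains M where "M > 0"
    "\<And>t. t > 0 \<Longrightarrow> norm ((1 - z + of_real t) powr (-s)) \<le> M * norm (complex_of_real (1 + t) powr (-s))"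
proof -
  \<comment> \<open>Constants of the comparison \<open>k1 * (1 + t) \<le> norm w\<close> and
    \<open>norm w \<le> k2 * (1 + t)\<close> for w = 1 - z + t. \<open>M\<close> adds the powers of
    both, so that either sign of \<open>Re s\<close> is covered.\<close>
  define k1 where "k1 = inverse (1 + norm z / r)"
  define k2 where "k2 = 1 + norm z"
  have k: "k1 > 0" "k2 > 0" using r by (auto simp: k1_def k2_def intro!: add_pos_nonneg)
  define E where "E = exp (pi * \<bar>Im (-s)\<bar>)"
  define M where "M = (k1 powr (-Re s) + k2 powr (-Re s)) * E"
  show ?thesis
  proof (rule that)
    show "M > 0" using k unfolding M_def E_def by (intro mult_pos_pos add_pos_nonneg) auto
    fix t :: real assume t: "t > 0"
    define w where "w = 1 - z + of_real t"
    \<comment> \<open>The point 1 + t lies on the removed ray, hence outside the ball around z; this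
      keeps w at distance at least r from 0.\<close>
    have "complex_of_real (1 + t) \<notin> hyp2f1_domain" using t by (simp add: hyp2f1_domain_altdef)
    hence "complex_of_real (1 + t) \<notin> ball z r" using ball by auto
    hence wr: "norm w \<ge> r" by (simp add: w_def dist_norm norm_minus_commute algebra_simps)
    have "1 + t = norm (w + z)" using t by (simp add: w_def flip: of_real_add)
       (metis abs_of_pos add_pos_pos norm_of_real of_real_1 of_real_add zero_less_one)
    hence "1 + t \<le> norm w + norm z" using norm_triangle_ineq[of w z] by simp
    also have "norm z \<le> norm z / r * norm w"
      using wr r mult_left_mono[of r "norm w" "norm z"] by (simp add: field_simps)
    finally have "1 + t \<le> (1 + norm z / r) * norm w" by (simp add: algebra_simps)
    hence low: "k1 * (1 + t) \<le> norm w"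
      using r unfolding k1_def by (simp add: field_simps add_pos_nonneg)
    have "norm w \<le> norm (complex_of_real (1 + t)) + norm z"
      using norm_triangle_ineq4[of "complex_of_real (1 + t)" z] by (simp add: w_def algebra_simps)
    also have "\<dots> \<le> k2 * (1 + t)" unfolding norm_of_real using t by (simp add: k2_def algebra_simps)
    finally have high: "norm w \<le> k2 * (1 + t)" .
    have "norm w powr (-Re s) \<le> (k1 powr (-Re s) + k2 powr (-Re s)) * (1 + t) powr (-Re s)"
    proof (cases "Re s \<ge> 0")
      case True
      have "norm w powr (-Re s) \<le> (k1 * (1 + t)) powr (-Re s)"
        using low True k t by (intro powr_mono2') auto
      also have "\<dots> = k1 powr (-Re s) * (1 + t) powr (-Re s)" using k t by (simp add: powr_mult)
      also have "\<dots> \<le> (k1 powr (-Re s) + k2 powr (-Re s)) * (1 + t) powr (-Re s)"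
        by (intro mult_right_mono) auto
      finally show ?thesis .
    next
      case False
      have "norm w powr (-Re s) \<le> (k2 * (1 + t)) powr (-Re s)"
        using high False by (intro powr_mono2) auto
      also have "\<dots> = k2 powr (-Re s) * (1 + t) powr (-Re s)" using k t by (simp add: powr_mult)
      also have "\<dots> \<le> (k1 powr (-Re s) + k2 powr (-Re s)) * (1 + t) powr (-Re s)"
        by (intro mult_right_mono) auto
      finally show ?thesis .
    qed
    hence "norm w powr (-Re s) * E \<le> (k1 powr (-Re s) + k2 powr (-Re s)) * (1 + t) powr (-Re s) * E"
      by (intro mult_right_mono) (auto simp: E_def)
    moreover have "norm (w powr (-s)) \<le> norm w powr (-Re s) * E"
      using norm_powr_le[of w "-s"] wr r by (cases "w = 0") (auto simp: E_def)
    moreover have "norm (complex_of_real (1 + t) powr (-s)) = (1 + t) powr (-Re s)"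
      using t by (subst norm_of_real_powr) auto
    ultimately show "norm ((1 - z + of_real t) powr (-s)) \<le> M * norm (complex_of_real (1 + t) powr (-s))"
      unfolding M_def w_def [symmetric] by (simp add: mult_ac)
  qed
qed

text \<open>No measurability of g itself is assumed, so the function is written as the given
  integrable one times a continuous quotient of powers on the half-line.\<close>

lemma measurable_mult_powr_one_minus_plus:
  assumes g: "set_integrable lborel {0<..} (\<lambda>t. g t * complex_of_real (1 + t) powr (-s))"
    and z: "z \<in> hyp2f1_domain"
  shows "(\<lambda>t. indicator {0<..} t *\<^sub>R (g t * (1 - z + of_real t) powr a)) \<in> borel_measurable lborel"
proof -
  have "continuous_on {0<..} (\<lambda>t. complex_of_real (1 + t) powr s * (1 - z + of_real t) powr a)"
    using z by (intro continuous_intros) (auto simp: complex_eq_iff hyp2f1_domain_altdef)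
  hence [measurable]: "(\<lambda>t. indicator {0<..} t *\<^sub>R
      (complex_of_real (1 + t) powr s * (1 - z + of_real t) powr a)) \<in> borel_measurable borel"
    by (intro borel_measurable_continuous_on_indicator) auto
  have [measurable]: "(\<lambda>t. indicator {0<..} t *\<^sub>R (g t * complex_of_real (1 + t) powr (-s))) \<in>
      borel_measurable lborel"
    using g unfolding set_integrable_def by (rule borel_measurable_integrable)
  have "(\<lambda>t. (indicator {0<..} t *\<^sub>R (g t * complex_of_real (1 + t) powr (-s))) *
      (indicator {0<..} t *\<^sub>R (complex_of_real (1 + t) powr s * (1 - z + of_real t) powr a)))
      \<in> borel_measurable lborel"
    by measurable
  also have "(\<lambda>t. (indicator {0<..} t *\<^sub>R (g t * complex_of_real (1 + t) powr (-s))) *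
      (indicator {0<..} t *\<^sub>R (complex_of_real (1 + t) powr s * (1 - z + of_real t) powr a))) =
     (\<lambda>t. indicator {0<..} t *\<^sub>R (g t * (1 - z + of_real t) powr a))"
  proof
    fix t :: real
    show "(indicator {0<..} t *\<^sub>R (g t * complex_of_real (1 + t) powr (-s))) *
      (indicator {0<..} t *\<^sub>R (complex_of_real (1 + t) powr s * (1 - z + of_real t) powr a)) =
      indicator {0<..} t *\<^sub>R (g t * (1 - z + of_real t) powr a)"
    proof (cases "t > 0")
      case True
      hence "complex_of_real (1 + t) powr s \<noteq> 0" by (simp del: of_real_add)
      thus ?thesis using True by (simp add: powr_minus del: of_real_add)
    qed simp
  qed
  finally show ?thesis .
qed

text \<open>Expand the power binomially in h and integrate term by term. This is used three ways: h
  = 0 gives integrability, z = 0 gives the series in the unit disc, and general z gives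
  holomorphy.\<close>

lemma set_integral_powr_one_minus_plus_sums:
  assumes g: "set_integrable lborel {0<..} (\<lambda>t. g t * complex_of_real (1 + t) powr (-s))"
    and ball: "ball z r \<subseteq> hyp2f1_domain" and h: "norm h < r"
  shows "set_integrable lborel {0<..} (\<lambda>t. g t * (1 - z + of_real t) powr (-s))"
    and "(\<lambda>n. pochhammer s n / fact n *
            (LINT t:{0<..}|lborel. g t * (1 - z + of_real t) powr (-(s + of_nat n))) * h ^ n)
          sums (LINT t:{0<..}|lborel. g t * (1 - (z + h) + of_real t) powr (-s))"
proof -
  have r: "r > 0" using h norm_ge_zero[of h] by linarith
  hence z: "z \<in> hyp2f1_domain" using ball by auto
  obtain M where M: "M > 0" "\<And>t. t > 0 \<Longrightarrow>
      norm ((1 - z + of_real t) powr (-s)) \<le> M * norm (complex_of_real (1 + t) powr (-s))"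
    using powr_one_minus_plus_bound[OF ball r] by blast
  define G where "G = (\<lambda>t. indicator {0<..} t *\<^sub>R (g t * complex_of_real (1 + t) powr (-s)))"
  have G: "integrable lborel G" using g by (simp add: G_def set_integrable_def)
  define F where "F = (\<lambda>n t. indicator {0<..} t *\<^sub>R (g t * (1 - z + of_real t) powr (-(s + of_nat n))))"
  \<comment> \<open>Each extra factor 1 / w costs at most 1 / r, since \<open>norm w\<close> is at
    least r.\<close>
  have F_le: "norm (F n t) \<le> norm (M * (1 / r) ^ n * norm (G t))" for n t
  proof (cases "t > 0")
    case True
    define w where "w = 1 - z + of_real t"
    have "complex_of_real (1 + t) \<notin> hyp2f1_domain" using True by (simp add: hyp2f1_domain_altdef)
    hence "complex_of_real (1 + t) \<notin> ball z r" using ball by auto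
    hence wr: "norm w \<ge> r" by (simp add: w_def dist_norm norm_minus_commute algebra_simps)
    hence w0: "w \<noteq> 0" using r by auto
    have "w powr (-(s + of_nat n)) = w powr (-s) / w powr of_nat n"
      by (subst powr_diff [symmetric]) simp
    also have "w powr of_nat n = w ^ n" using w0 by (intro powr_nat') auto
    finally have "norm (w powr (-(s + of_nat n))) = norm (w powr (-s)) * (1 / norm w) ^ n"
      by (simp add: norm_divide norm_power power_divide)
    also have "\<dots> \<le> (M * norm (complex_of_real (1 + t) powr (-s))) * (1 / r) ^ n"
      using M(1) M(2)[OF True] wr r unfolding w_def
      by (intro mult_mono power_mono divide_left_mono mult_pos_pos) auto
    finally have "norm (g t) * norm (w powr (-(s + of_nat n))) \<le>
        norm (g t) * ((M * norm (complex_of_real (1 + t) powr (-s))) * (1 / r) ^ n)"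
      by (intro mult_left_mono) auto
    thus ?thesis using True M(1) r
      by (simp add: F_def G_def norm_mult w_def abs_mult power_abs mult_ac del: of_real_add)
  qed (simp add: F_def)
  have F: "integrable lborel (F n)" for n
    by (rule Bochner_Integration.integrable_bound[OF integrable_mult_right[OF integrable_norm[OF G]]])
       (use F_le measurable_mult_powr_one_minus_plus[OF g z] in \<open>auto simp: F_def\<close>)
  from F[of 0] show "set_integrable lborel {0<..} (\<lambda>t. g t * (1 - z + of_real t) powr (-s))"
    by (simp add: F_def set_integrable_def)
  define f where "f = (\<lambda>n t. pochhammer s n / fact n * h ^ n * F n t)"
  \<comment> \<open>With both remaining parameters equal to 1 the coefficient is (s)_n / n!, so
    \<open>d\<close> is a convergent binomial majorant at the radius norm h / r, which is below
    1.\<close>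
  define d where "d = (\<lambda>n. norm (hyp_coeff s 1 1 n * of_real (norm h / r) ^ n))"
  have d: "summable d"
    unfolding d_def by (rule summable_norm_hyp_coeff_power) (use h r in \<open>simp add: norm_divide\<close>)
  have f_le: "norm (f n t) \<le> d n * (M * norm (G t))" for n t
  proof -
    have "norm (f n t) \<le> norm (pochhammer s n / fact n * h ^ n) * (M * (1 / r) ^ n * norm (G t))"
      unfolding f_def norm_mult[of _ "F n t"]
      using F_le[of n t] M(1) r by (intro mult_left_mono) (auto simp: abs_mult)
    also have "\<dots> = d n * (M * norm (G t))"
      using r by (simp add: d_def hyp_coeff_def norm_mult norm_divide norm_power power_divide
                            pochhammer_fact [symmetric])
    finally show ?thesis .
  qed
  have int: "integrable lborel (f n)" for n
    unfolding f_def by (intro integrable_mult_right F)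
  have AE: "AE t in lborel. summable (\<lambda>n. norm (f n t))"
    using f_le by (intro AE_I2 summable_comparison_test'[OF summable_mult2[OF d]]) auto
  have "summable (\<lambda>n. LINT t|lborel. norm (f n t))"
  proof (rule summable_comparison_test'[OF summable_mult2[OF d]])
    fix n
    have "(LINT t|lborel. norm (f n t)) \<le> (LINT t|lborel. d n * (M * norm (G t)))"
      using f_le int G by (intro integral_mono) auto
    also have "\<dots> = d n * (M * (LINT t|lborel. norm (G t)))" by simp
    finally show "norm (LINT t|lborel. norm (f n t)) \<le> d n * (M * (LINT t|lborel. norm (G t)))"
      by simp
  qed
  from sums_integral[OF int AE this]
  have "(\<lambda>n. integral\<^sup>L lborel (f n)) sums (LINT t|lborel. (\<Sum>n. f n t))" .
  moreover have "(\<Sum>n. f n t) = indicator {0<..} t *\<^sub>R (g t * (1 - (z + h) + of_real t) powr (-s))" for t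
  proof (cases "t > 0")
    case True
    \<comment> \<open>The map w to 1 + t - w carries this ball onto the ball around z, which lies in
      the slit plane.\<close>
    have "ball (1 - z + of_real t) r \<inter> \<real>\<^sub>\<le>\<^sub>0 = {}"
    proof (intro equals0I)
      fix w assume w: "w \<in> ball (1 - z + of_real t) r \<inter> \<real>\<^sub>\<le>\<^sub>0"
      hence "1 + of_real t - w \<in> ball z r" by (simp add: dist_norm norm_minus_commute algebra_simps)
      hence "1 + of_real t - w \<in> hyp2f1_domain" using ball by blast
      from one_minus_plus_notin_nonpos_Reals[OF this, of t] True w show False by simp
    qed
    from sums_mult[OF powr_minus_diff_sums[OF this h, of s], of "g t"]
    have "(\<lambda>n. f n t) sums (g t * (1 - (z + h) + of_real t) powr (-s))"
      using True by (simp add: f_def F_def mult_ac algebra_simps)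
    thus ?thesis using True by (simp add: sums_iff)
  qed (simp add: f_def F_def)
  ultimately show "(\<lambda>n. pochhammer s n / fact n *
            (LINT t:{0<..}|lborel. g t * (1 - z + of_real t) powr (-(s + of_nat n))) * h ^ n)
          sums (LINT t:{0<..}|lborel. g t * (1 - (z + h) + of_real t) powr (-s))"
    unfolding f_def set_lebesgue_integral_def integral_mult_right_zero F_def
    by (simp add: mult_ac)
qed

lemma set_integrable_powr_one_minus_plus:
  assumes g: "set_integrable lborel {0<..} (\<lambda>t. g t * complex_of_real (1 + t) powr (-s))"
    and z: "z \<in> hyp2f1_domain"
  shows "set_integrable lborel {0<..} (\<lambda>t. g t * (1 - z + of_real t) powr (-s))"
proof -
  obtain r where "r > 0" "ball z r \<subseteq> hyp2f1_domain"
    using open_hyp2f1_domain z openE by blast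
  thus ?thesis using set_integral_powr_one_minus_plus_sums(1)[OF g, of z r 0] by simp
qed

lemma holomorphic_set_integral_powr_one_minus_plus:
  assumes g: "set_integrable lborel {0<..} (\<lambda>t. g t * complex_of_real (1 + t) powr (-s))"
  shows "(\<lambda>z. LINT t:{0<..}|lborel. g t * (1 - z + of_real t) powr (-s)) holomorphic_on hyp2f1_domain"
    (is "?J holomorphic_on _")
  unfolding holomorphic_on_open[OF open_hyp2f1_domain] field_differentiable_def [symmetric]
proof
  fix z assume "z \<in> hyp2f1_domain"
  then obtain r where r: "r > 0" "ball z r \<subseteq> hyp2f1_domain"
    using open_hyp2f1_domain openE by blast
  have "?J holomorphic_on ball z r"
  proof (rule power_series_holomorphic)
    fix w assume "w \<in> ball z r"
    hence "norm (w - z) < r" by (simp add: dist_norm norm_minus_commute)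
    from set_integral_powr_one_minus_plus_sums(2)[OF g r(2) this]
    show "(\<lambda>n. pochhammer s n / fact n *
            (LINT t:{0<..}|lborel. g t * (1 - z + of_real t) powr (-(s + of_nat n))) * (w - z) ^ n)
          sums ?J w" by simp
  qed
  thus "?J field_differentiable at z"
    using r(1) by (intro holomorphic_on_imp_differentiable_at[of _ "ball z r"]) auto
qed

text \<open>The n-th Taylor coefficient at 0 is the integral at z = 0 with s + n for s. Its Gamma
  factors split off (\<alpha>)_n, (\<beta>)_n and 1 / (\<gamma>)_n, while the (s)_n of the binomial
  series is absorbed by \<open>rGamma (s + of_nat n)\<close>.\<close>

lemma set_integral_hyp_neg_sums:
  assumes C: "Re C > 0" and A: "Re (A - C + s) > 0" and B: "Re (B - C + s) > 0"
    and nz: "A + B - C + s \<notin> \<int>\<^sub>\<le>\<^sub>0" and z: "norm z < 1"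
  shows "(\<lambda>n. Gamma C * Gamma (A - C + s) * Gamma (B - C + s) * (rGamma (A + B - C + s) * rGamma s) *
            (hyp_coeff (A - C + s) (B - C + s) (A + B - C + s) n * z ^ n)) sums
         (LINT t:{0<..}|lborel. complex_of_real t powr (C - 1) * hyp_neg A B C t * (1 - z + of_real t) powr (-s))"
proof -
  define \<alpha> where "\<alpha> = A - C + s"
  define \<beta> where "\<beta> = B - C + s"
  define \<gamma> where "\<gamma> = A + B - C + s"
  have \<alpha>: "\<alpha> \<notin> \<int>\<^sub>\<le>\<^sub>0" "Gamma \<alpha> \<noteq> 0" and \<beta>: "\<beta> \<notin> \<int>\<^sub>\<le>\<^sub>0" "Gamma \<beta> \<noteq> 0"
    using A B pos_Re_not_nonpos_Int by (auto simp: \<alpha>_def \<beta>_def Gamma_eq_zero_iff)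
  have val: "pochhammer s n / fact n *
      (LINT t:{0<..}|lborel. complex_of_real t powr (C - 1) * hyp_neg A B C t *
         (1 - 0 + of_real t) powr (-(s + of_nat n))) * z ^ n =
      Gamma C * Gamma \<alpha> * Gamma \<beta> * (rGamma \<gamma> * rGamma s) * (hyp_coeff \<alpha> \<beta> \<gamma> n * z ^ n)" for n
  proof -
    have "(LINT t:{0<..}|lborel. complex_of_real t powr (C - 1) * hyp_neg A B C t *
         (1 - 0 + of_real t) powr (-(s + of_nat n))) =
        Gamma C * Gamma (\<alpha> + of_nat n) * Gamma (\<beta> + of_nat n) *
          (rGamma (\<gamma> + of_nat n) * rGamma (s + of_nat n))"
      using set_integral_hyp_neg_one_plus_powr(2)[of C A "s + of_nat n" B] A B C
      by (simp add: \<alpha>_def \<beta>_def \<gamma>_def add_ac)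
    also have "Gamma (\<alpha> + of_nat n) = pochhammer \<alpha> n * Gamma \<alpha>"
      using \<alpha> by (simp add: pochhammer_Gamma)
    also have "Gamma (\<beta> + of_nat n) = pochhammer \<beta> n * Gamma \<beta>"
      using \<beta> by (simp add: pochhammer_Gamma)
    also have "rGamma (\<gamma> + of_nat n) = rGamma \<gamma> / pochhammer \<gamma> n"
      using pochhammer_rGamma[of \<gamma> n] pochhammer_eq_0_imp_nonpos_Int[of \<gamma> n] nz
      by (auto simp: \<gamma>_def)
    finally show ?thesis
      by (simp add: hyp_coeff_def pochhammer_rGamma[of s n] mult_ac)
  qed
  have *: "set_integrable lborel {0<..}
           (\<lambda>t. (complex_of_real t powr (C - 1) * hyp_neg A B C t) * of_real (1 + t) powr (-s))"
    by (rule set_integral_hyp_neg_one_plus_powr(1)[OF C A B])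
  from set_integral_powr_one_minus_plus_sums(2)[OF * ball_subset_hyp2f1_domain z]
  show ?thesis unfolding val unfolding \<alpha>_def \<beta>_def \<gamma>_def by simp
qed

section \<open>Analytic continuation of the hypergeometric series\<close>

text \<open>The predicate under the choice operator of \<open>hyp2f1\<close>, stated with
  \<open>sums\<close> so that series can be combined directly. The two forms agree because the
  series converges in the unit disc.\<close>

definition hyp2f1_continuation :: "complex \<Rightarrow> complex \<Rightarrow> complex \<Rightarrow> (complex \<Rightarrow> complex) \<Rightarrow> bool" where
  "hyp2f1_continuation a b c f \<longleftrightarrow> f holomorphic_on hyp2f1_domain \<and>
     (\<forall>z. norm z < 1 \<longrightarrow> (\<lambda>n. hyp_coeff a b c n * z ^ n) sums f z)"

lemma hyp2f1_continuation_commute: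
  "hyp2f1_continuation a b c f \<longleftrightarrow> hyp2f1_continuation b a c f"
  unfolding hyp2f1_continuation_def by (subst hyp_coeff_commute) (rule refl)

text \<open>The integral is holomorphic on the slit plane and equals a nonzero multiple of the
  series in the disc, so dividing by that constant gives the continuation.\<close>

lemma hyp2f1_continuation_exists_pos:
  assumes a: "Re a > 0" and b: "Re b > 0" and c: "c \<notin> \<int>\<^sub>\<le>\<^sub>0"
  shows "\<exists>f. hyp2f1_continuation a b c f"
proof -
  \<comment> \<open>Given s, the parameters A, B, C solve the three equations in \<open>eq\<close>.
    This s is large enough that C has positive real part, and positive so that
    \<open>rGamma s\<close> is nonzero.\<close>
  define s where "s = complex_of_real (1 + \<bar>Re (a + b - c)\<bar>)"
  define C where "C = s + c - a - b"
  define A where "A = c - b"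
  define B where "B = c - a"
  have eq: "A - C + s = a" "B - C + s = b" "A + B - C + s = c" by (auto simp: A_def B_def C_def)
  have C: "Re C > 0" by (auto simp: C_def s_def abs_if)
  have s: "Re s > 0" by (auto simp: s_def)
  define K where "K = Gamma C * Gamma a * Gamma b * (rGamma c * rGamma s)"
  have K: "K \<noteq> 0"
    using C a b c s pos_Re_not_nonpos_Int by (auto simp: K_def Gamma_eq_zero_iff rGamma_eq_zero_iff)
  define J where "J = (\<lambda>z. LINT t:{0<..}|lborel.
      complex_of_real t powr (C - 1) * hyp_neg A B C t * (1 - z + of_real t) powr (-s))"
  have "J holomorphic_on hyp2f1_domain"
    unfolding J_def using C a b
    by (intro holomorphic_set_integral_powr_one_minus_plus set_integral_hyp_neg_one_plus_powr(1))
       (auto simp: eq)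
  hence "(\<lambda>z. J z / K) holomorphic_on hyp2f1_domain"
    using K by (intro holomorphic_intros) auto
  moreover have "(\<lambda>n. hyp_coeff a b c n * z ^ n) sums (J z / K)" if "norm z < 1" for z
  proof -
    have "(\<lambda>n. K * (hyp_coeff a b c n * z ^ n)) sums J z"
      using set_integral_hyp_neg_sums[of C A s B z] C a b c that unfolding eq J_def K_def by blast
    from sums_divide[OF this, of K] show ?thesis using K by simp
  qed
  ultimately show ?thesis unfolding hyp2f1_continuation_def by blast
qed

text \<open>The contiguous relation F(a,b;c;z) = F(a,b+1;c;z) - (a/c) z F(a+1,b+1;c+1;z), used to
  push the domain of existence one unit to the left in b.\<close>

lemma hyp2f1_continuation_lower_second:
  assumes c: "c \<notin> \<int>\<^sub>\<le>\<^sub>0"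
    and f: "hyp2f1_continuation a (b + 1) c f"
    and g: "hyp2f1_continuation (a + 1) (b + 1) (c + 1) g"
  shows "hyp2f1_continuation a b c (\<lambda>z. f z - a / c * (g z * z))"
  unfolding hyp2f1_continuation_def
proof (intro conjI allI impI)
  show "(\<lambda>z. f z - a / c * (g z * z)) holomorphic_on hyp2f1_domain"
    using f g unfolding hyp2f1_continuation_def by (intro holomorphic_intros) auto
  fix z :: complex assume z: "norm z < 1"
  \<comment> \<open>The terms of z * g(z), shifted by one place and given a zero constant term so
    that they align with the other series.\<close>
  define d where "d = (\<lambda>n. case n of 0 \<Rightarrow> 0 | Suc m \<Rightarrow> hyp_coeff (a + 1) (b + 1) (c + 1) m * z ^ m * z)"
  have "(\<lambda>n. d (Suc n)) sums (g z * z)"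
    unfolding d_def using g z unfolding hyp2f1_continuation_def by (auto intro!: sums_mult2)
  hence "d sums (g z * z + d 0)" by (rule sums_Suc)
  hence "d sums (g z * z)" by (simp add: d_def)
  hence "(\<lambda>n. hyp_coeff a (b + 1) c n * z ^ n - a / c * d n) sums (f z - a / c * (g z * z))"
    using f z unfolding hyp2f1_continuation_def by (intro sums_diff sums_mult) auto
  moreover have "hyp_coeff a (b + 1) c n * z ^ n - a / c * d n = hyp_coeff a b c n * z ^ n" for n
  proof (cases n)
    case (Suc m)
    have c0: "c \<noteq> 0" using c by auto
    have cm: "pochhammer (c + 1) m \<noteq> 0"
      using pochhammer_eq_0_imp_nonpos_Int[of "c + 1" m] not_nonpos_Int_plus_1[OF c] by blast
    have m: "of_nat m + 1 \<noteq> (0::complex)" using of_nat_neq_0[of m, where 'a = complex] by (simp add: add_ac)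
    \<comment> \<open>The final bracket equals b, which turns (b + 1)_m into (b)_(m+1).\<close>
    have "hyp_coeff a (b + 1) c (Suc m) - a / c * hyp_coeff (a + 1) (b + 1) (c + 1) m =
      a * pochhammer (a + 1) m * pochhammer (b + 1) m / (c * pochhammer (c + 1) m * ((of_nat m + 1) * fact m)) *
        ((b + 1 + of_nat m) - (of_nat m + 1))"
      unfolding hyp_coeff_def pochhammer_rec[of a] pochhammer_rec[of c] pochhammer_Suc[of "b + 1"]
      using c0 cm m by (simp add: divide_simps) (simp add: algebra_simps)
    also have "\<dots> = hyp_coeff a b c (Suc m)"
      unfolding hyp_coeff_def pochhammer_rec by (simp add: mult_ac add_ac)
    finally show ?thesis unfolding Suc d_def by (simp add: algebra_simps)
  qed (simp add: d_def)
  ultimately show "(\<lambda>n. hyp_coeff a b c n * z ^ n) sums (f z - a / c * (g z * z))" by simp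
qed

text \<open>Induction on N with all parameters free: the step raises b by one and may raise a and c
  too, which preserves the conditions on both.\<close>

lemma hyp2f1_continuation_exists_pos_first:
  assumes "Re a > 0" "c \<notin> \<int>\<^sub>\<le>\<^sub>0" "Re b > - real N"
  shows "\<exists>f. hyp2f1_continuation a b c f"
  using assms
proof (induction N arbitrary: a b c)
  case 0
  thus ?case using hyp2f1_continuation_exists_pos[of a b c] by simp
next
  case (Suc N)
  obtain f where "hyp2f1_continuation a (b + 1) c f"
    using Suc.IH[of a c "b + 1"] Suc.prems by auto
  moreover obtain g where "hyp2f1_continuation (a + 1) (b + 1) (c + 1) g"
    using Suc.IH[of "a + 1" "c + 1" "b + 1"] Suc.prems not_nonpos_Int_plus_1[of c] by auto
  ultimately show ?case using hyp2f1_continuation_lower_second Suc.prems by blast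
qed

text \<open>The same induction without a condition on a. In its base case \<open>Re b\<close> is
  positive, so the previous lemma applies with the upper parameters exchanged.\<close>

lemma hyp2f1_continuation_exists_aux:
  assumes "c \<notin> \<int>\<^sub>\<le>\<^sub>0" "Re b > - real N"
  shows "\<exists>f. hyp2f1_continuation a b c f"
  using assms
proof (induction N arbitrary: a b c)
  case 0
  obtain M :: nat where "- Re a < real M" using reals_Archimedean2 by blast
  hence "\<exists>f. hyp2f1_continuation b a c f"
    using 0 by (intro hyp2f1_continuation_exists_pos_first[where N = M]) auto
  thus ?case by (subst hyp2f1_continuation_commute)
next
  case (Suc N)
  obtain f where "hyp2f1_continuation a (b + 1) c f"
    using Suc.IH[of c "b + 1"] Suc.prems by auto
  moreover obtain g where "hyp2f1_continuation (a + 1) (b + 1) (c + 1) g"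
    using Suc.IH[of "c + 1" "b + 1"] Suc.prems not_nonpos_Int_plus_1[of c] by auto
  ultimately show ?case using hyp2f1_continuation_lower_second Suc.prems by blast
qed

theorem hyp2f1_continuation_exists:
  assumes "c \<notin> \<int>\<^sub>\<le>\<^sub>0"
  shows "\<exists>f. hyp2f1_continuation a b c f"
proof -
  obtain M :: nat where "- Re b < real M" using reals_Archimedean2 by blast
  thus ?thesis using assms by (intro hyp2f1_continuation_exists_aux[where N = M]) auto
qed

lemma hyp2f1_continuation_hyp2f1:
  assumes "c \<notin> \<int>\<^sub>\<le>\<^sub>0"
  shows "hyp2f1_continuation a b c (hyp2f1 a b c)"
proof -
  define P where "P = (\<lambda>f. f holomorphic_on hyp2f1_domain \<and>
     (\<forall>z. norm z < 1 \<longrightarrow> f z = (\<Sum>n. hyp_coeff a b c n * z ^ n)))"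
  have iff: "hyp2f1_continuation a b c f \<longleftrightarrow> P f" for f
    unfolding hyp2f1_continuation_def P_def
    using summable_norm_cancel[OF summable_norm_hyp_coeff_power] by (auto simp: sums_iff)
  have "hyp2f1 a b c = (SOME f. P f)"
    unfolding hyp2f1_def P_def hyp_coeff_def ..
  moreover have "\<exists>f. P f" using hyp2f1_continuation_exists[OF assms] iff by blast
  ultimately show ?thesis unfolding iff by (metis someI_ex)
qed

lemma hyp2f1_holomorphic:
  "c \<notin> \<int>\<^sub>\<le>\<^sub>0 \<Longrightarrow> hyp2f1 a b c holomorphic_on hyp2f1_domain"
  using hyp2f1_continuation_hyp2f1 unfolding hyp2f1_continuation_def by blast

lemma hyp2f1_sums:
  "c \<notin> \<int>\<^sub>\<le>\<^sub>0 \<Longrightarrow> norm z < 1 \<Longrightarrow> (\<lambda>n. hyp_coeff a b c n * z ^ n) sums hyp2f1 a b c z"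
  using hyp2f1_continuation_hyp2f1 unfolding hyp2f1_continuation_def by blast

section \<open>Pfaff's transformation\<close>

text \<open>The coefficient identity behind Pfaff's transformation. Writing (a)_n (a + n)_(m-n) as
  (a)_m and n! times the signed binomial coefficient as (-m)_n turns the sum into
  Chu-Vandermonde.\<close>

lemma hyp_coeff_Pfaff:
  assumes c: "c \<notin> \<int>\<^sub>\<le>\<^sub>0"
  shows "(\<Sum>n\<le>m. hyp_coeff a (c - b) c n * (-1) ^ n * (pochhammer (a + of_nat n) (m - n) / fact (m - n))) =
           hyp_coeff a b c m"
proof -
  have "hyp_coeff a (c - b) c n * (-1) ^ n * (pochhammer (a + of_nat n) (m - n) / fact (m - n)) =
      pochhammer a m / fact m * ((pochhammer (c - b) n * pochhammer (- of_nat m) n) /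
         (of_nat (fact n) * pochhammer c n))" if "n \<le> m" for n
  proof -
    have "of_nat (m choose n) = (-1) ^ n * pochhammer (- of_nat m :: complex) n / fact n"
      by (simp add: binomial_gbinomial gbinomial_pochhammer)
    moreover have "of_nat (m choose n) = (fact m / (fact n * fact (m - n)) :: complex)"
      using that by (rule binomial_fact)
    ultimately have "(-1) ^ n * ((-1) ^ n * pochhammer (- of_nat m :: complex) n) =
        (-1) ^ n * (fact m / fact (m - n))"
      by (simp add: field_simps)
    hence "pochhammer (- of_nat m :: complex) n = (-1) ^ n * fact m / fact (m - n)"
      by (simp flip: mult.assoc power_add add: mult_2 [symmetric])
    thus ?thesis
      by (simp add: hyp_coeff_def pochhammer_product[OF that, of a] mult_ac)
  qed
  hence "(\<Sum>n\<le>m. hyp_coeff a (c - b) c n * (-1) ^ n * (pochhammer (a + of_nat n) (m - n) / fact (m - n))) =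
      pochhammer a m / fact m * (\<Sum>n=0..m. (pochhammer (c - b) n * pochhammer (- of_nat m) n) /
         (of_nat (fact n) * pochhammer c n))"
    unfolding sum_distrib_left atLeast0AtMost by (intro sum.cong refl) simp
  also have "(\<Sum>n=0..m. (pochhammer (c - b) n * pochhammer (- of_nat m) n) /
         (of_nat (fact n) * pochhammer c n)) = pochhammer (c - (c - b)) m / pochhammer c m"
    using not_nonpos_Int_add_of_nat[OF c] by (intro Vandermonde_pochhammer) (auto simp: eq_neg_iff_add_eq_0)
  finally show ?thesis by (simp add: hyp_coeff_def mult_ac)
qed

lemma norm_pochhammer_le:
  fixes a :: complex
  assumes "norm a \<le> r"
  shows "norm (pochhammer a k) \<le> pochhammer r k"
  unfolding pochhammer_prod prod_norm [symmetric]
proof (intro prod_mono conjI)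
  fix i
  show "norm (a + of_nat i) \<le> r + real i"
    using norm_triangle_ineq[of a "of_nat i"] assms by simp
qed auto

lemma one_minus_powr_sums:
  fixes z s :: complex
  assumes "norm z < 1"
  shows "(\<lambda>k. pochhammer s k / fact k * z ^ k) sums (1 - z) powr (-s)"
proof -
  have "ball (1::complex) 1 \<inter> \<real>\<^sub>\<le>\<^sub>0 = {}"
  proof (intro equals0I)
    fix w :: complex assume w: "w \<in> ball 1 1 \<inter> \<real>\<^sub>\<le>\<^sub>0"
    hence "Re (1 - w) < 1" using complex_Re_le_cmod[of "1 - w"] by (simp add: dist_norm)
    thus False using w by (auto simp: complex_nonpos_Reals_iff)
  qed
  from powr_minus_diff_sums[OF this assms, of s] show ?thesis by simp
qed

text \<open>Expanding (1 - z) to the power -(a + n) in each term gives a double series. Its rows sum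
  to the right-hand side, its antidiagonals to the left-hand side by
  \<open>hyp_coeff_Pfaff\<close>.\<close>

lemma hyp2f1_Pfaff_near_0:
  assumes c: "c \<notin> \<int>\<^sub>\<le>\<^sub>0" and z: "norm z < 1 / 3"
  shows "hyp2f1 a b c z = (1 - z) powr (-a) * hyp2f1 a (c - b) c (z / (z - 1))"
proof -
  define k where "k = hyp_coeff a (c - b) c"
  define \<rho> where "\<rho> = norm z"
  have \<rho>: "0 \<le> \<rho>" "\<rho> < 1 / 3" using z by (auto simp: \<rho>_def)
  have z1: "z \<noteq> 1" using z by auto
  have norm1: "1 - \<rho> \<le> norm (1 - z)" using norm_triangle_ineq2[of 1 z] by (simp add: \<rho>_def)
  have q: "\<rho> / (1 - \<rho>) < 1" "\<rho> / (1 - \<rho>) \<ge> 0" using \<rho> by (auto simp: field_simps)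
  define T where "T = (\<lambda>(n, j). k n * (-z) ^ n * (pochhammer (a + of_nat n) j / fact j * z ^ j))"
  \<comment> \<open>A nonnegative majorant of \<open>T\<close>, with row sums \<open>g n\<close>.
    These are terms of an absolutely convergent power series at \<rho> / (1 - \<rho>), which is
    below 1 for the given z.\<close>
  define R where "R = (\<lambda>(n, j). norm (k n) * \<rho> ^ n * (pochhammer (norm a + real n) j / fact j * \<rho> ^ j))"
  define g where "g = (\<lambda>n. norm (k n) * \<rho> ^ n * (1 - \<rho>) powr (-(norm a + real n)))"
  have R_nonneg: "R x \<ge> 0" for x
    using \<rho> unfolding R_def pochhammer_prod
    by (auto split: prod.splits intro!: mult_nonneg_nonneg divide_nonneg_nonneg prod_nonneg)
  have R_row: "((\<lambda>j. R (n, j)) has_sum g n) UNIV" for n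
  proof (rule sums_nonneg_imp_has_sum)
    have "(\<lambda>j. (-(norm a + real n) gchoose j) * (-\<rho>) ^ j) sums (1 + (-\<rho>)) powr (-(norm a + real n))"
      by (rule gen_binomial_real) (use \<rho> in auto)
    moreover have "(-(norm a + real n) gchoose j) * (-\<rho>) ^ j =
        pochhammer (norm a + real n) j / fact j * \<rho> ^ j" for j
    proof -
      have "(-1) ^ j * (-\<rho>) ^ j = \<rho> ^ j" by (simp flip: power_mult_distrib)
      moreover have "(-(norm a + real n) gchoose j) * (-\<rho>) ^ j =
          pochhammer (norm a + real n) j / fact j * ((-1) ^ j * (-\<rho>) ^ j)"
        unfolding gbinomial_pochhammer by (simp add: add.commute)
      ultimately show ?thesis by simp
    qed
    ultimately have "(\<lambda>j. pochhammer (norm a + real n) j / fact j * \<rho> ^ j) sums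
        (1 - \<rho>) powr (-(norm a + real n))" by simp
    from sums_mult[OF this] show "(\<lambda>j. R (n, j)) sums g n" by (simp add: R_def g_def)
  qed (rule R_nonneg)
  have g: "g n = (1 - \<rho>) powr (-norm a) * norm (k n * of_real (\<rho> / (1 - \<rho>)) ^ n)" for n
  proof -
    have "(1 - \<rho>) powr (-(norm a + real n)) = (1 - \<rho>) powr (-norm a) / (1 - \<rho>) powr real n"
      by (subst powr_diff [symmetric]) simp
    also have "(1 - \<rho>) powr real n = (1 - \<rho>) ^ n" using \<rho> by (intro powr_realpow) auto
    finally show ?thesis using \<rho> q unfolding norm_mult norm_power norm_of_real
      by (simp add: g_def power_divide)
  qed
  have "norm (complex_of_real (\<rho> / (1 - \<rho>))) < 1" unfolding norm_of_real using q by linarith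
  hence "summable g"
    unfolding g k_def by (intro summable_mult summable_norm_hyp_coeff_power)
  hence g_sum: "(\<lambda>n. norm (g n)) summable_on UNIV"
    using R_nonneg \<rho> by (intro norm_summable_imp_summable_on) (simp add: g_def)
  have "(\<lambda>x. norm (R x)) summable_on (UNIV \<times> UNIV)"
    unfolding Infinite_Sum.abs_summable_on_Sigma_iff
  proof (intro conjI ballI)
    fix n show "(\<lambda>j. norm (R (n, j))) summable_on UNIV"
      using R_row[of n] R_nonneg by (auto simp: summable_on_def)
  next
    have "infsum (\<lambda>j. norm (R (n, j))) UNIV = g n" for n
      using R_row[of n] R_nonneg by (simp add: infsumI)
    thus "(\<lambda>n. norm (infsum (\<lambda>j. norm (R (n, j))) UNIV)) summable_on UNIV"
      using g_sum by simp
  qed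
  moreover have "norm (T x) \<le> norm (R x)" for x
  proof -
    obtain n j where x: "x = (n, j)" by force
    have "norm (a + of_nat n) \<le> norm a + real n" using norm_triangle_ineq[of a "of_nat n"] by simp
    hence "norm (pochhammer (a + of_nat n) j) \<le> pochhammer (norm a + real n) j"
      by (rule norm_pochhammer_le)
    hence "norm (T x) \<le> R x"
      using \<rho>(1) unfolding x T_def R_def
      by (auto simp: norm_mult norm_power norm_divide \<rho>_def intro!: mult_left_mono mult_right_mono divide_right_mono)
    thus ?thesis using R_nonneg by simp
  qed
  ultimately have "(\<lambda>x. norm (T x)) summable_on (UNIV \<times> UNIV)"
    by (rule Infinite_Sum.abs_summable_on_comparison_test)
  hence "T summable_on (UNIV \<times> UNIV)" by (rule Infinite_Sum.abs_summable_summable)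
  then obtain S where S: "(T has_sum S) (UNIV \<times> UNIV)" by (auto simp: summable_on_def)
  have row: "((\<lambda>j. T (n, j)) has_sum ((1 - z) powr (-a) * (k n * (z / (z - 1)) ^ n))) UNIV" for n
  proof (rule norm_summable_imp_has_sum)
    have nz: "norm z < 1" using z by simp
    have "(\<lambda>j. T (n, j)) sums (k n * (-z) ^ n * (1 - z) powr (-(a + of_nat n)))"
      unfolding T_def using sums_mult[OF one_minus_powr_sums[OF nz, of "a + of_nat n"]] by simp
    also have "(1 - z) powr (-(a + of_nat n)) = (1 - z) powr (-a) / (1 - z) powr of_nat n"
      by (subst powr_diff [symmetric]) simp
    also have "(1 - z) powr of_nat n = (1 - z) ^ n" using z1 by (intro powr_nat') auto
    also have "k n * (-z) ^ n * ((1 - z) powr (-a) / (1 - z) ^ n) =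
        (1 - z) powr (-a) * (k n * ((-z) / (1 - z)) ^ n)"
      unfolding power_divide by simp
    also have "(-z) / (1 - z) = z / (z - 1)" using z1 by (simp add: field_simps)
    finally show "(\<lambda>j. T (n, j)) sums ((1 - z) powr (-a) * (k n * (z / (z - 1)) ^ n))" .
    have "summable (\<lambda>j. norm (k n * (-z) ^ n) * norm (hyp_coeff (a + of_nat n) 1 1 j * z ^ j))"
      by (intro summable_mult summable_norm_hyp_coeff_power nz)
    moreover have "hyp_coeff (a + of_nat n) 1 1 j = pochhammer (a + of_nat n) j / fact j" for j
      by (simp add: hyp_coeff_def pochhammer_fact [symmetric])
    ultimately show "summable (\<lambda>j. norm (T (n, j)))"
      unfolding T_def prod.case norm_mult[of "k n * (-z) ^ n"] by simp
  qed
  have "norm (z / (z - 1)) \<le> \<rho> / (1 - \<rho>)"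
    unfolding norm_divide using norm1 \<rho> by (auto simp: \<rho>_def norm_minus_commute intro!: divide_left_mono mult_pos_pos)
  hence nzz: "norm (z / (z - 1)) < 1" using q by linarith
  have "(\<lambda>n. (1 - z) powr (-a) * (k n * (z / (z - 1)) ^ n)) sums S"
    using has_sum_SigmaD[OF S row] by (intro has_sum_imp_sums) simp
  moreover have "(\<lambda>n. (1 - z) powr (-a) * (k n * (z / (z - 1)) ^ n)) sums
      ((1 - z) powr (-a) * hyp2f1 a (c - b) c (z / (z - 1)))"
    unfolding k_def by (intro sums_mult hyp2f1_sums c nzz)
  ultimately have 1: "S = (1 - z) powr (-a) * hyp2f1 a (c - b) c (z / (z - 1))"
    by (rule sums_unique2)
  \<comment> \<open>Regroups the pairs (n, j) by the total degree m = n + j; truncated subtraction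
    is harmless as n is at most m.\<close>
  have bij: "bij_betw (\<lambda>(m, n). (n, m - n)) (SIGMA m:UNIV. {..m}) (UNIV \<times> (UNIV :: nat set))"
    by (rule bij_betwI[where g = "\<lambda>(n, j). (n + j, n)"]) auto
  have "((\<lambda>x. T (case x of (m, n) \<Rightarrow> (n, m - n))) has_sum S) (SIGMA m:UNIV. {..m})"
    using has_sum_reindex_bij_betw[OF bij, of T S] S by simp
  moreover have "((\<lambda>n. T (case (m, n) of (m, n) \<Rightarrow> (n, m - n))) has_sum (hyp_coeff a b c m * z ^ m)) {..m}" for m
  proof -
    have "(\<Sum>n\<le>m. T (n, m - n)) = (\<Sum>n\<le>m. hyp_coeff a (c - b) c n * (-1) ^ n *
        (pochhammer (a + of_nat n) (m - n) / fact (m - n))) * z ^ m"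
      unfolding sum_distrib_right
    proof (intro sum.cong refl)
      fix n assume "n \<in> {..m}"
      hence "z ^ m = z ^ n * z ^ (m - n)" by (simp flip: power_add)
      moreover have "(-z) ^ n = (-1) ^ n * z ^ n" by (rule power_minus)
      ultimately show "T (n, m - n) = hyp_coeff a (c - b) c n * (-1) ^ n *
          (pochhammer (a + of_nat n) (m - n) / fact (m - n)) * z ^ m"
        by (simp add: T_def k_def)
    qed
    also have "\<dots> = hyp_coeff a b c m * z ^ m" unfolding hyp_coeff_Pfaff[OF c] ..
    finally show ?thesis using has_sum_finite[of "{..m}" "\<lambda>n. T (n, m - n)"] by simp
  qed
  ultimately have "((\<lambda>m. hyp_coeff a b c m * z ^ m) has_sum S) UNIV"
    by (rule has_sum_SigmaD)
  hence "(\<lambda>m. hyp_coeff a b c m * z ^ m) sums S" by (rule has_sum_imp_sums)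
  moreover have "(\<lambda>m. hyp_coeff a b c m * z ^ m) sums hyp2f1 a b c z"
    using z by (intro hyp2f1_sums c) auto
  ultimately show ?thesis using 1 sums_unique2 by metis
qed

text \<open>Identity theorem on the half-plane Re z < 1/2, which is where z / (z - 1) lies in the
  unit disc.\<close>

lemma hyp2f1_Pfaff:
  assumes c: "c \<notin> \<int>\<^sub>\<le>\<^sub>0" and z: "Re z < 1 / 2"
  shows "hyp2f1 a b c z = (1 - z) powr (-a) * hyp2f1 a (c - b) c (z / (z - 1))"
proof -
  define H where "H = {z. Re z < 1 / 2}"
  have H_sub: "H \<subseteq> hyp2f1_domain" by (auto simp: H_def hyp2f1_domain_altdef)
  have norm_lt: "norm (w / (w - 1)) < 1" and ne1: "w \<noteq> 1" if "w \<in> H" for w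
  proof -
    show "w \<noteq> 1" using that by (auto simp: H_def)
    have "(Re w)\<^sup>2 < (Re w - 1)\<^sup>2" using that by (simp add: H_def power2_eq_square algebra_simps)
    hence "norm w < norm (w - 1)" by (simp add: cmod_def)
    thus "norm (w / (w - 1)) < 1" using \<open>w \<noteq> 1\<close> by (simp add: norm_divide)
  qed
  have dom: "w / (w - 1) \<in> hyp2f1_domain" if "w \<in> H" for w
    using norm_lt[OF that] ball_subset_hyp2f1_domain by auto
  have "(hyp2f1 a (c - b) c \<circ> (\<lambda>w. w / (w - 1))) holomorphic_on H"
    using ne1 dom by (intro holomorphic_on_compose_gen[OF _ hyp2f1_holomorphic[OF c]] holomorphic_intros) auto
  moreover have "(\<lambda>w. (1 - w) powr (-a)) holomorphic_on H"
    by (intro holomorphic_intros) (auto simp: H_def complex_nonpos_Reals_iff)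
  ultimately have hol: "(\<lambda>w. (1 - w) powr (-a) * hyp2f1 a (c - b) c (w / (w - 1))) holomorphic_on H"
    unfolding o_def by (intro holomorphic_on_mult)
  show ?thesis
  proof (rule analytic_continuation_open[of "ball 0 (1/3)" H "hyp2f1 a b c"])
    show "open H" unfolding H_def by (rule open_halfspace_Re_lt)
    show "connected H" unfolding H_def by (intro convex_connected convex_halfspace_Re_lt)
    show "ball 0 (1/3) \<subseteq> H"
    proof
      fix w :: complex assume "w \<in> ball 0 (1/3)"
      thus "w \<in> H" using complex_Re_le_cmod[of w] by (simp add: H_def)
    qed
    show "hyp2f1 a b c holomorphic_on H"
      using hyp2f1_holomorphic[OF c] H_sub holomorphic_on_subset by blast
    show "(\<lambda>w. (1 - w) powr (-a) * hyp2f1 a (c - b) c (w / (w - 1))) holomorphic_on H" by (rule hol)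
    show "hyp2f1 a b c w = (1 - w) powr (-a) * hyp2f1 a (c - b) c (w / (w - 1))"
      if "w \<in> ball 0 (1/3)" for w
      using that by (intro hyp2f1_Pfaff_near_0 c) simp
    show "z \<in> H" using z by (simp add: H_def)
  qed auto
qed

text \<open>Pfaff at z = -t: then z / (z - 1) = t / (1 + t) is in the unit disc and the series
  applies. This replaces \<open>hyp_neg\<close> by the true hypergeometric function.\<close>

lemma hyp2f1_minus_of_real:
  assumes c: "c \<notin> \<int>\<^sub>\<le>\<^sub>0" and t: "t > 0"
  shows "hyp2f1 a b c (- of_real t) = hyp_neg a b c t"
proof -
  have t1: "norm (complex_of_real (t / (1 + t))) < 1" unfolding norm_of_real using t by simp
  have "- complex_of_real t / (- of_real t - 1) = of_real (t / (1 + t))"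
    using t by (simp add: field_simps complex_eq_iff)
  hence "hyp2f1 a b c (- of_real t) = of_real (1 + t) powr (-a) * hyp2f1 a (c - b) c (of_real (t / (1 + t)))"
    using hyp2f1_Pfaff[OF c, of "- of_real t" a b] t by simp
  also have "hyp2f1 a (c - b) c (of_real (t / (1 + t))) =
      (\<Sum>n. hyp_coeff a (c - b) c n * of_real (t / (1 + t)) ^ n)"
    by (rule sums_unique[OF hyp2f1_sums[OF c t1]])
  finally show ?thesis by (simp add: hyp_neg_def)
qed

section \<open>The integral formulas\<close>

text \<open>Both sides are holomorphic in z on the connected slit plane and have the same power
  series in the unit disc.\<close>

theorem set_integral_hyp2f1_powr:
  fixes A B C s :: complex
  assumes C: "Re C > 0" and A: "Re (A - C + s) > 0" and B: "Re (B - C + s) > 0"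
    and nz: "A + B - C + s \<notin> \<int>\<^sub>\<le>\<^sub>0" and z: "z \<in> hyp2f1_domain"
  shows "set_integrable lborel {0<..} (\<lambda>t. complex_of_real t powr (C - 1) * hyp2f1 A B C (- of_real t) *
           (1 - z + of_real t) powr (-s))" (is "?int")
    and "(LINT t:{0<..}|lborel. complex_of_real t powr (C - 1) * hyp2f1 A B C (- of_real t) *
           (1 - z + of_real t) powr (-s)) =
         Gamma C * Gamma (A - C + s) * Gamma (B - C + s) * (rGamma (A + B - C + s) * rGamma s) *
           hyp2f1 (A - C + s) (B - C + s) (A + B - C + s) z" (is "?val")
proof -
  define J where "J = (\<lambda>z. LINT t:{0<..}|lborel.
      complex_of_real t powr (C - 1) * hyp_neg A B C t * (1 - z + of_real t) powr (-s))"
  define K where "K = Gamma C * Gamma (A - C + s) * Gamma (B - C + s) * (rGamma (A + B - C + s) * rGamma s)"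
  have eq: "hyp2f1 A B C (- of_real t) = hyp_neg A B C t" if "t \<in> {0<..}" for t
    using hyp2f1_minus_of_real[OF pos_Re_not_nonpos_Int[OF C]] that by simp
  note int = set_integral_hyp_neg_one_plus_powr(1)[OF C A B]
  show ?int
    using set_integrable_powr_one_minus_plus[OF int z]
    by (rule set_integrable_cong[THEN iffD1, rotated -1]) (simp_all add: eq)
  have "J z = K * hyp2f1 (A - C + s) (B - C + s) (A + B - C + s) z"
  proof (rule analytic_continuation_open[of "ball 0 1" hyp2f1_domain J])
    show "J holomorphic_on hyp2f1_domain"
      unfolding J_def by (rule holomorphic_set_integral_powr_one_minus_plus[OF int])
    show "(\<lambda>z. K * hyp2f1 (A - C + s) (B - C + s) (A + B - C + s) z) holomorphic_on hyp2f1_domain"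
      by (intro holomorphic_intros hyp2f1_holomorphic nz)
    fix w :: complex assume "w \<in> ball 0 1"
    hence w: "norm w < 1" by simp
    show "J w = K * hyp2f1 (A - C + s) (B - C + s) (A + B - C + s) w"
      using set_integral_hyp_neg_sums[OF C A B nz w] sums_mult[OF hyp2f1_sums[OF nz w], of K]
      unfolding J_def K_def by (rule sums_unique2)
  qed (use open_hyp2f1_domain connected_hyp2f1_domain ball_subset_hyp2f1_domain z in auto)
  also have "J z = (LINT t:{0<..}|lborel. complex_of_real t powr (C - 1) * hyp2f1 A B C (- of_real t) *
           (1 - z + of_real t) powr (-s))"
    unfolding J_def by (intro set_lebesgue_integral_cong) (auto simp: eq)
  finally show ?val unfolding K_def .
qed

section \<open>Specialisation to \<open>w2\<close> and \<open>w6\<close> by an affine change of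
  variable\<close>

lemma hyp2f1_domain_of_real: "x < 1 \<Longrightarrow> complex_of_real x \<in> hyp2f1_domain"
  by (simp add: hyp2f1_domain_altdef)

lemma hyp2f1_commute: "hyp2f1 a b c = hyp2f1 b a c"
  unfolding hyp2f1_def by (simp add: mult_ac)

text \<open>Covers the reflection y = -t and the translation y = 1 + t together; the Jacobian factor
  is 1 in both cases.\<close>

lemma set_integral_lborel_affine:
  fixes f :: "real \<Rightarrow> complex"
  assumes c: "\<bar>c\<bar> = 1" and A: "\<And>t. x + c * t \<in> A \<longleftrightarrow> t \<in> B"
  shows "set_integrable lborel A f \<longleftrightarrow> set_integrable lborel B (\<lambda>t. f (x + c * t))"
    and "(LINT y:A|lborel. f y) = (LINT t:B|lborel. f (x + c * t))"
proof -
  have c0: "c \<noteq> 0" using c by auto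
  have ind: "indicator A (x + c * t) = (indicator B t :: real)" for t
    using A by (simp add: indicator_def)
  show "set_integrable lborel A f \<longleftrightarrow> set_integrable lborel B (\<lambda>t. f (x + c * t))"
    using lborel_integrable_real_affine_iff[OF c0, of "\<lambda>y. indicator A y *\<^sub>R f y" x]
    unfolding set_integrable_def ind by simp
  show "(LINT y:A|lborel. f y) = (LINT t:B|lborel. f (x + c * t))"
    using lborel_integral_real_affine[OF c0, of "\<lambda>y. indicator A y *\<^sub>R f y" x] c
    unfolding set_lebesgue_integral_def ind by simp
qed

text \<open>With y = -t, z = 1 - x and s = 1 - \<mu>, the kernel base x - y becomes 1 - z + t, and
  the argument z is the one in \<open>w5\<close>.\<close>

lemma set_integral_w2:
  assumes a: "Re (a - \<mu>) > 0" and b: "Re (b - \<mu>) > 0" and c: "Re (2 - c) > 0"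
    and nz: "a - \<mu> + (b - \<mu>) - (c - \<mu>) + 1 \<notin> \<int>\<^sub>\<le>\<^sub>0" and x: "x > 0"
  shows "set_integrable lborel {..<0} (\<lambda>y. w2 y a b c * complex_of_real (x - y) powr (\<mu> - 1))"
    and "(LINT y:{..<0}|lborel. w2 y a b c * complex_of_real (x - y) powr (\<mu> - 1)) =
           Gamma (a - \<mu>) * Gamma (b - \<mu>) * Gamma (2 - c) *
           (rGamma (a + b - c - \<mu> + 1) * rGamma (1 - \<mu>)) * w5 x (a - \<mu>) (b - \<mu>) (c - \<mu>)"
proof -
  define A B C s where "A = a - c + 1" and "B = b - c + 1" and "C = 2 - c" and "s = 1 - \<mu>"
  define z where "z = complex_of_real (1 - x)"
  have eqs: "A - C + s = a - \<mu>" "B - C + s = b - \<mu>" "A + B - C + s = a + b - c - \<mu> + 1"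
    "a - \<mu> + (b - \<mu>) - (c - \<mu>) + 1 = a + b - c - \<mu> + 1"
    by (auto simp: A_def B_def C_def s_def)
  have z: "z \<in> hyp2f1_domain" unfolding z_def using x by (intro hyp2f1_domain_of_real) simp
  have eq: "complex_of_real t powr (C - 1) * hyp2f1 A B C (- of_real t) * (1 - z + of_real t) powr (-s) =
      w2 (0 + (-1) * t) a b c * complex_of_real (x - (0 + (-1) * t)) powr (\<mu> - 1)" if "t \<in> {0<..}" for t
    using that by (simp add: w2_def A_def B_def C_def s_def z_def)
  note base = set_integral_hyp2f1_powr[of C A s B z, unfolded eqs]
  have sub: "0 + (-1) * t \<in> {..<0} \<longleftrightarrow> t \<in> {0<..}" for t :: real by simp
  have unit: "\<bar>-1::real\<bar> = 1" by simp
  have "set_integrable lborel {0<..} (\<lambda>t. complex_of_real t powr (C - 1) * hyp2f1 A B C (- of_real t) *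
      (1 - z + of_real t) powr (-s))"
    using a b c nz z unfolding eqs by (intro base(1)) (auto simp: C_def)
  hence "set_integrable lborel {0<..} (\<lambda>t. w2 (0 + (-1) * t) a b c * complex_of_real (x - (0 + (-1) * t)) powr (\<mu> - 1))"
    by (rule set_integrable_cong[THEN iffD1, rotated -1]) (simp_all only: eq)
  thus "set_integrable lborel {..<0} (\<lambda>y. w2 y a b c * complex_of_real (x - y) powr (\<mu> - 1))"
    by (rule set_integral_lborel_affine(1)[OF unit sub, THEN iffD2])
  have "(LINT y:{..<0}|lborel. w2 y a b c * complex_of_real (x - y) powr (\<mu> - 1)) =
      (LINT t:{0<..}|lborel. w2 (0 + (-1) * t) a b c * complex_of_real (x - (0 + (-1) * t)) powr (\<mu> - 1))"
    by (rule set_integral_lborel_affine(2)[OF unit sub])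
  also have "\<dots> = (LINT t:{0<..}|lborel. complex_of_real t powr (C - 1) * hyp2f1 A B C (- of_real t) *
      (1 - z + of_real t) powr (-s))"
    by (rule set_lebesgue_integral_cong, simp, intro allI impI, rule eq [symmetric])
  also have "\<dots> = Gamma C * Gamma (a - \<mu>) * Gamma (b - \<mu>) * (rGamma (a + b - c - \<mu> + 1) * rGamma s) *
      hyp2f1 (a - \<mu>) (b - \<mu>) (a + b - c - \<mu> + 1) z"
    using a b c nz z unfolding eqs by (intro base(2)) (auto simp: C_def)
  finally show "(LINT y:{..<0}|lborel. w2 y a b c * complex_of_real (x - y) powr (\<mu> - 1)) =
           Gamma (a - \<mu>) * Gamma (b - \<mu>) * Gamma (2 - c) *
           (rGamma (a + b - c - \<mu> + 1) * rGamma (1 - \<mu>)) * w5 x (a - \<mu>) (b - \<mu>) (c - \<mu>)"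
    unfolding w5_def eqs by (simp add: C_def s_def z_def mult_ac)
qed

text \<open>With y = 1 + t, z = x and s = 1 - \<mu>, the argument 1 - y of the function in
  \<open>w6\<close> is -t. The upper parameters come out as b - \<mu>, a - \<mu> and are exchanged
  by symmetry.\<close>

lemma set_integral_w6:
  assumes a: "Re (a - \<mu>) > 0" and b: "Re (b - \<mu>) > 0" and c: "Re (c - a - b + 1) > 0"
    and nz: "c - \<mu> \<notin> \<int>\<^sub>\<le>\<^sub>0" and x: "x < 1"
  shows "set_integrable lborel {1<..} (\<lambda>y. w6 y a b c * complex_of_real (y - x) powr (\<mu> - 1))"
    and "(LINT y:{1<..}|lborel. w6 y a b c * complex_of_real (y - x) powr (\<mu> - 1)) =
           Gamma (a - \<mu>) * Gamma (b - \<mu>) * Gamma (c - a - b + 1) *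
           (rGamma (c - \<mu>) * rGamma (1 - \<mu>)) * w1 x (a - \<mu>) (b - \<mu>) (c - \<mu>)"
proof -
  define A B C s where "A = c - a" and "B = c - b" and "C = c - a - b + 1" and "s = 1 - \<mu>"
  define z where "z = complex_of_real x"
  have eqs: "A - C + s = b - \<mu>" "B - C + s = a - \<mu>" "A + B - C + s = c - \<mu>"
    by (auto simp: A_def B_def C_def s_def)
  have z: "z \<in> hyp2f1_domain" unfolding z_def using x by (intro hyp2f1_domain_of_real)
  have eq: "complex_of_real t powr (C - 1) * hyp2f1 A B C (- of_real t) * (1 - z + of_real t) powr (-s) =
      w6 (1 + 1 * t) a b c * complex_of_real (1 + 1 * t - x) powr (\<mu> - 1)" if "t \<in> {0<..}" for t
    using that by (simp add: w6_def A_def B_def C_def s_def z_def algebra_simps)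
  note base = set_integral_hyp2f1_powr[of C A s B z, unfolded eqs]
  have sub: "1 + 1 * t \<in> {1<..} \<longleftrightarrow> t \<in> {0<..}" for t :: real by simp
  have unit: "\<bar>1::real\<bar> = 1" by simp
  have "set_integrable lborel {0<..} (\<lambda>t. complex_of_real t powr (C - 1) * hyp2f1 A B C (- of_real t) *
      (1 - z + of_real t) powr (-s))"
    using a b c nz z by (intro base(1)) (auto simp: C_def)
  hence "set_integrable lborel {0<..} (\<lambda>t. w6 (1 + 1 * t) a b c * complex_of_real (1 + 1 * t - x) powr (\<mu> - 1))"
    by (rule set_integrable_cong[THEN iffD1, rotated -1]) (simp_all only: eq)
  thus "set_integrable lborel {1<..} (\<lambda>y. w6 y a b c * complex_of_real (y - x) powr (\<mu> - 1))"
    by (rule set_integral_lborel_affine(1)[OF unit sub, THEN iffD2])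
  have "(LINT y:{1<..}|lborel. w6 y a b c * complex_of_real (y - x) powr (\<mu> - 1)) =
      (LINT t:{0<..}|lborel. w6 (1 + 1 * t) a b c * complex_of_real (1 + 1 * t - x) powr (\<mu> - 1))"
    by (rule set_integral_lborel_affine(2)[OF unit sub])
  also have "\<dots> = (LINT t:{0<..}|lborel. complex_of_real t powr (C - 1) * hyp2f1 A B C (- of_real t) *
      (1 - z + of_real t) powr (-s))"
    by (rule set_lebesgue_integral_cong, simp, intro allI impI, rule eq [symmetric])
  also have "\<dots> = Gamma C * Gamma (b - \<mu>) * Gamma (a - \<mu>) * (rGamma (c - \<mu>) * rGamma s) *
      hyp2f1 (b - \<mu>) (a - \<mu>) (c - \<mu>) z"
    using a b c nz z by (intro base(2)) (auto simp: C_def)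
  finally show "(LINT y:{1<..}|lborel. w6 y a b c * complex_of_real (y - x) powr (\<mu> - 1)) =
           Gamma (a - \<mu>) * Gamma (b - \<mu>) * Gamma (c - a - b + 1) *
           (rGamma (c - \<mu>) * rGamma (1 - \<mu>)) * w1 x (a - \<mu>) (b - \<mu>) (c - \<mu>)"
    unfolding w1_def hyp2f1_commute[of "b - \<mu>"] by (simp add: C_def s_def z_def mult_ac)
qed

text \<open>Integrability is asserted along with each value because a Bochner integral defaults to 0
  for a non-integrable function. Writing the denominators with \<open>rGamma\<close> realises the
  convention that 1/Gamma is entire.\<close>

theorem mainTheorem14:
  fixes a b c \<mu> :: complex
  shows
    "(0 < Re (a - \<mu>) \<and> 0 < Re (b - \<mu>) \<and> 0 < Re (2 - c) \<and>
      2 - c \<notin> \<int>\<^sub>\<le>\<^sub>0 \<and> (a - \<mu>) + (b - \<mu>) - (c - \<mu>) + 1 \<notin> \<int>\<^sub>\<le>\<^sub>0 \<longrightarrow>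
      (\<forall>x \<in> {0<..<1} \<union> {1<..}.
        set_integrable lborel {..<0} (\<lambda>y. w2 y a b c * complex_of_real (x - y) powr (\<mu> - 1)) \<and>
        (LINT y:{..<0}|lborel. w2 y a b c * complex_of_real (x - y) powr (\<mu> - 1)) =
          Gamma (a - \<mu>) * Gamma (b - \<mu>) * Gamma (2 - c) *
          (rGamma (a + b - c - \<mu> + 1) * rGamma (1 - \<mu>)) *
          w5 x (a - \<mu>) (b - \<mu>) (c - \<mu>))) \<and>
     (0 < Re (a - \<mu>) \<and> 0 < Re (b - \<mu>) \<and> 0 < Re (c - a - b + 1) \<and>
      c - a - b + 1 \<notin> \<int>\<^sub>\<le>\<^sub>0 \<and> c - \<mu> \<notin> \<int>\<^sub>\<le>\<^sub>0 \<longrightarrow>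
      (\<forall>x \<in> {..<0} \<union> {0<..<1}.
        set_integrable lborel {1<..} (\<lambda>y. w6 y a b c * complex_of_real (y - x) powr (\<mu> - 1)) \<and>
        (LINT y:{1<..}|lborel. w6 y a b c * complex_of_real (y - x) powr (\<mu> - 1)) =
          Gamma (a - \<mu>) * Gamma (b - \<mu>) * Gamma (c - a - b + 1) *
          (rGamma (c - \<mu>) * rGamma (1 - \<mu>)) *
          w1 x (a - \<mu>) (b - \<mu>) (c - \<mu>)))"
proof (intro conjI impI; elim conjE; intro ballI conjI)
  fix x :: real
  assume *: "0 < Re (a - \<mu>)" "0 < Re (b - \<mu>)"
  {
    assume 1: "0 < Re (2 - c)" "(a - \<mu>) + (b - \<mu>) - (c - \<mu>) + 1 \<notin> \<int>\<^sub>\<le>\<^sub>0"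
      and "x \<in> {0<..<1} \<union> {1<..}"
    hence x: "x > 0" by auto
    show "set_integrable lborel {..<0} (\<lambda>y. w2 y a b c * complex_of_real (x - y) powr (\<mu> - 1))"
      by (rule set_integral_w2(1)[OF * 1 x])
    show "(LINT y:{..<0}|lborel. w2 y a b c * complex_of_real (x - y) powr (\<mu> - 1)) =
          Gamma (a - \<mu>) * Gamma (b - \<mu>) * Gamma (2 - c) *
          (rGamma (a + b - c - \<mu> + 1) * rGamma (1 - \<mu>)) *
          w5 x (a - \<mu>) (b - \<mu>) (c - \<mu>)"
      by (rule set_integral_w2(2)[OF * 1 x])
  next
    assume 2: "0 < Re (c - a - b + 1)" "c - \<mu> \<notin> \<int>\<^sub>\<le>\<^sub>0" and "x \<in> {..<0} \<union> {0<..<1}"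
    hence x: "x < 1" by auto
    show "set_integrable lborel {1<..} (\<lambda>y. w6 y a b c * complex_of_real (y - x) powr (\<mu> - 1))"
      by (rule set_integral_w6(1)[OF * 2 x])
    show "(LINT y:{1<..}|lborel. w6 y a b c * complex_of_real (y - x) powr (\<mu> - 1)) =
          Gamma (a - \<mu>) * Gamma (b - \<mu>) * Gamma (c - a - b + 1) *
          (rGamma (c - \<mu>) * rGamma (1 - \<mu>)) *
          w1 x (a - \<mu>) (b - \<mu>) (c - \<mu>)"
      by (rule set_integral_w6(2)[OF * 2 x])
  }
qed

end
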